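(* On the flag manifold $M=SU(3)/T_{max}$, each of the invariant $f$-structures $$J_2=(1,-1,1),\quad J_3=(1,1,-1),\quad J_4=(1,-1,-1),$$ $$f_1=(1,1,0),\ f_2=(1,0,1),\ f_3=(0,1,1),\ f_4=(1,-1,0),\ f_5=(1,0,-1),\ f_6=(0,1,-1),$$ $$f_7=(1,0,0),\ f_8=(0,1,0),\ f_9=(0,0,1)$$ is a Hermitian $f$-structure with respect to every invariant Riemannian metric $g=(1,t,s)$, $t,s>0$.
   Context: Setting. $T_{max}\subset SU(3)$ is the subgroup of diagonal matrices. Let $\mathfrak g=\mathfrak{su}(3)=\mathfrak h\oplus\mathfrak m$, where $\mathfrak h$ consists of the diagonal matrices in $\mathfrak{su}(3)$ and $\mathfrak m$ consists of the matrices $$D(a,b,c)=\begin{pmatrix}0&a&\overline c\\-\overline a&0&b\\-c&-\overline b&0\end{pmatrix},\quad a,b,c\in\mathbb C.$$ Identify $\mathfrak m$ with the tangent space $T_o M$ of $M=SU(3)/T_{max}$ at $o=T_{max}$. Put $\mathfrak m_1=\{D(a,0,0)\}$, $\mathfrak m_2=\{D(0,b,0)\}$, $\mathfrak m_3=\{D(0,0,c)\}$, so $\mathfrak m=\mathfrak m_1\oplus\mathfrak m_2\oplus\mathfrak m_3$. Invariant metrics. Let $\langle X,Y\rangle_o=-\frac12\operatorname{Re}\operatorname{tr}(XY)$. For $\lambda_1,\lambda_2,\lambda_3>0$, $g=(\lambda_1,\lambda_2,\lambda_3)$ denotes the $SU(3)$-invariant Riemannian metric on $M$ whose value at $o$ makes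 the $\mathfrak m_j$ mutually orthogonal and equals $\lambda_j\langle\cdot,\cdot\rangle_o$ on $\mathfrak m_j$, $j=1,2,3$. Every $SU(3)$-invariant Riemannian metric on $M$ is of this form; up to homothety it can be written $g=(1,t,s)$ with $t,s>0$. Invariant $f$-structures. An $f$-structure is a $(1,1)$-tensor field $f$ with $f^3+f=0$. For $\zeta_1,\zeta_2,\zeta_3\in\{-1,0,1\}$, $f=(\zeta_1,\zeta_2,\zeta_3)$ denotes the $SU(3)$-invariant $f$-structure on $M$ given at $o$ by $D(a,b,c)\mapsto D(\zeta_1 ia,\zeta_2 ib,\zeta_3 ic)$. Each is a metric $f$-structure (i.e. $g(fX,Y)+g(X,fY)=0$) for every invariant Riemannian metric $g$. Hermitian $f$-structures. Let $\nabla$ be the Levi-Civita connection of $g$ and $\nabla_X(f)Y=\nabla_X(fY)-f\nabla_XY$. The composition tensor of a metric $f$-structure is $$T(X,Y)=\tfrac14 f\big(\nabla_{fX}(f)fY-\nabla_{f^2X}(f)f^2Y\big).$$ A metric $f$-structure is a Hermitian $f$-structure ($Hf$-structure) if $T(X,Y)=0$ for all vector fields $X,Y$. *)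

theory Defs
  imports "HOL-Analysis.Analysis" "HOL-Library.Function_Algebras"
begin

text \<open>
  The flag manifold \<open>M = SU(3) / T\<close>. The smooth structure on \<open>M\<close> is given by its algebra of smooth
  functions, tangent vectors are directional derivatives acting on smooth functions, and vector
  fields, the Lie bracket and connections are built on these.
\<close>

type_synonym cmat = "complex^3^3"


subsection \<open>The group and the flag manifold\<close>

definition adj :: "cmat \<Rightarrow> cmat" where
  "adj A = (\<chi> i j. cnj (A $ j $ i))"

definition SU3 :: "cmat set" where
  "SU3 = {A. A ** adj A = mat 1 \<and> det A = 1}"

definition Tmax :: "cmat set" where
  "Tmax = {A \<in> SU3. \<forall>i j. i \<noteq> j \<longrightarrow> A $ i $ j = 0}"

definition coset :: "cmat \<Rightarrow> cmat set" where
  "coset g = (\<lambda>h. g ** h) ` Tmax"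

typedef flag = "coset ` SU3"
proof -
  have "adj (mat 1) = mat 1"
    by (auto simp: adj_def mat_def vec_eq_iff)
  then have "mat 1 \<in> SU3"
    by (simp add: SU3_def)
  then show ?thesis by blast
qed

definition quot :: "cmat \<Rightarrow> flag" where
  "quot g = Abs_flag (coset g)"

definition act :: "cmat \<Rightarrow> flag \<Rightarrow> flag" where
  "act g p = Abs_flag ((\<lambda>x. g ** x) ` Rep_flag p)"

definition origin :: flag where
  "origin = quot (mat 1)"


subsection \<open>Smooth functions\<close>

fun Ck_on :: "nat \<Rightarrow> 'a::real_normed_vector set \<Rightarrow> ('a \<Rightarrow> 'b::real_normed_vector) \<Rightarrow> bool" where
  "Ck_on 0 U F \<longleftrightarrow> continuous_on U F"
| "Ck_on (Suc k) U F \<longleftrightarrow> (\<forall>x\<in>U. F differentiable (at x)) \<and>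
     (\<forall>v. Ck_on k U (\<lambda>x. frechet_derivative F (at x) v))"

definition smooth_on_open :: "'a::real_normed_vector set \<Rightarrow> ('a \<Rightarrow> 'b::real_normed_vector) \<Rightarrow> bool" where
  "smooth_on_open U F \<longleftrightarrow> open U \<and> (\<forall>k. Ck_on k U F)"

text \<open>
  \<open>SU3\<close> is an embedded submanifold of the space of matrices, so a function on it is smooth iff it
  locally extends to a smooth function of the ambient space. The quotient map is a surjective
  submersion, so a function on the quotient is smooth iff its pullback to \<open>SU3\<close> is.
\<close>

definition smooth_on_SU3 :: "(cmat \<Rightarrow> real) \<Rightarrow> bool" where
  "smooth_on_SU3 F \<longleftrightarrow>
     (\<forall>g\<in>SU3. \<exists>U E. g \<in> U \<and> smooth_on_open U E \<and> (\<forall>x \<in> U \<inter> SU3. E x = F x))"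

definition smooth :: "(flag \<Rightarrow> real) \<Rightarrow> bool" where
  "smooth \<phi> \<longleftrightarrow> smooth_on_SU3 (\<phi> \<circ> quot)"


subsection \<open>Tangent vectors\<close>

definition matD :: "complex \<Rightarrow> complex \<Rightarrow> complex \<Rightarrow> cmat" where
  "matD a b c = vector [vector [0, a, cnj c], vector [- cnj a, 0, b], vector [- c, - cnj b, 0]]"

definition \<mm> :: "cmat set" where
  "\<mm> = {matD a b c | a b c. True}"

definition mexp :: "cmat \<Rightarrow> cmat" where
  "mexp A = (\<Sum>n. (1 / fact n) *\<^sub>R (((**) A ^^ n) (mat 1)))"

text \<open>
  Tangent vectors are functionals on smooth functions; they are set to \<open>0\<close> on functions that are
  not smooth, so that equality and the pointwise operations on functionals are those of the
  tangent spaces.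
\<close>

type_synonym tangent = "(flag \<Rightarrow> real) \<Rightarrow> real"

definition scale :: "real \<Rightarrow> tangent \<Rightarrow> tangent" where
  "scale r v = (\<lambda>\<phi>. r * v \<phi>)"

text \<open>The identification of \<open>\<mm>\<close> with the tangent space at the origin:
  \<open>A\<close> is mapped to the velocity at time \<open>0\<close> of the curve \<open>exp (t A) T\<close>.\<close>

definition at_origin :: "cmat \<Rightarrow> tangent" where
  "at_origin A = (\<lambda>\<phi>. if smooth \<phi> then deriv (\<lambda>t. \<phi> (act (mexp (t *\<^sub>R A)) origin)) 0 else 0)"

definition push :: "cmat \<Rightarrow> tangent \<Rightarrow> tangent" where
  "push g v = (\<lambda>\<phi>. v (\<lambda>p. \<phi> (act g p)))"

text \<open>These are all the tangent vectors at \<open>p\<close>: the Lie algebra of \<open>SU3\<close> is the direct sum of \<open>\<mm>\<close>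
  and the diagonal part, and the curves \<open>g exp (t H) T\<close> with \<open>H\<close> diagonal are constant.\<close>

definition tangent_space :: "flag \<Rightarrow> tangent set" where
  "tangent_space p = {push g (at_origin A) | g A. g \<in> SU3 \<and> act g origin = p \<and> A \<in> \<mm>}"


subsection \<open>Vector fields and connections\<close>

type_synonym vfield = "flag \<Rightarrow> tangent"

definition deriv_along :: "vfield \<Rightarrow> (flag \<Rightarrow> real) \<Rightarrow> flag \<Rightarrow> real" where
  "deriv_along X \<phi> = (\<lambda>p. X p \<phi>)"

definition vector_fields :: "vfield set" where
  "vector_fields = {X. (\<forall>p. X p \<in> tangent_space p) \<and> (\<forall>\<phi>. smooth \<phi> \<longrightarrow> smooth (deriv_along X \<phi>))}"

definition smul :: "(flag \<Rightarrow> real) \<Rightarrow> vfield \<Rightarrow> vfield" where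
  "smul \<phi> X = (\<lambda>p. scale (\<phi> p) (X p))"

definition bracket :: "vfield \<Rightarrow> vfield \<Rightarrow> vfield" where
  "bracket X Y = (\<lambda>p \<phi>. X p (deriv_along Y \<phi>) - Y p (deriv_along X \<phi>))"

type_synonym connection = "vfield \<Rightarrow> vfield \<Rightarrow> vfield"

definition affine_connection :: "connection \<Rightarrow> bool" where
  "affine_connection \<D> \<longleftrightarrow>
     (\<forall>X\<in>vector_fields. \<forall>Y\<in>vector_fields. \<D> X Y \<in> vector_fields) \<and>
     (\<forall>X\<in>vector_fields. \<forall>Y\<in>vector_fields. \<forall>Z\<in>vector_fields.
        \<D> (X + Y) Z = \<D> X Z + \<D> Y Z \<and> \<D> X (Y + Z) = \<D> X Y + \<D> X Z) \<and>
     (\<forall>X\<in>vector_fields. \<forall>Y\<in>vector_fields. \<forall>\<phi>. smooth \<phi> \<longrightarrow>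
        \<D> (smul \<phi> X) Y = smul \<phi> (\<D> X Y) \<and>
        \<D> X (smul \<phi> Y) = smul (deriv_along X \<phi>) Y + smul \<phi> (\<D> X Y))"

type_synonym tensor02 = "flag \<Rightarrow> tangent \<Rightarrow> tangent \<Rightarrow> real"

definition levi_civita :: "tensor02 \<Rightarrow> connection \<Rightarrow> bool" where
  "levi_civita g \<D> \<longleftrightarrow> affine_connection \<D> \<and>
     (\<forall>X\<in>vector_fields. \<forall>Y\<in>vector_fields. \<D> X Y - \<D> Y X = bracket X Y) \<and>
     (\<forall>X\<in>vector_fields. \<forall>Y\<in>vector_fields. \<forall>Z\<in>vector_fields. \<forall>p.
        deriv_along X (\<lambda>q. g q (Y q) (Z q)) p = g p (\<D> X Y p) (Z p) + g p (Y p) (\<D> X Z p))"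


subsection \<open>Hermitian f-structures\<close>

type_synonym tensor11 = "flag \<Rightarrow> tangent \<Rightarrow> tangent"

definition app :: "tensor11 \<Rightarrow> vfield \<Rightarrow> vfield" where
  "app f X = (\<lambda>p. f p (X p))"

definition tensor_field11 :: "tensor11 \<Rightarrow> bool" where
  "tensor_field11 f \<longleftrightarrow>
     (\<forall>p. \<forall>v\<in>tangent_space p. f p v \<in> tangent_space p \<and>
        (\<forall>w\<in>tangent_space p. f p (v + w) = f p v + f p w) \<and>
        (\<forall>r. f p (scale r v) = scale r (f p v))) \<and>
     (\<forall>X\<in>vector_fields. app f X \<in> vector_fields)"

definition f_structure :: "tensor11 \<Rightarrow> bool" where
  "f_structure f \<longleftrightarrow> tensor_field11 f \<and>
     (\<forall>X\<in>vector_fields. app f (app f (app f X)) + app f X = 0)"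

definition metric_f_structure :: "tensor02 \<Rightarrow> tensor11 \<Rightarrow> bool" where
  "metric_f_structure g f \<longleftrightarrow> f_structure f \<and>
     (\<forall>X\<in>vector_fields. \<forall>Y\<in>vector_fields. \<forall>p.
        g p (app f X p) (Y p) + g p (X p) (app f Y p) = 0)"

definition cov_deriv11 :: "connection \<Rightarrow> tensor11 \<Rightarrow> vfield \<Rightarrow> vfield \<Rightarrow> vfield" where
  "cov_deriv11 \<D> f X Y = \<D> X (app f Y) - app f (\<D> X Y)"

definition composition_tensor :: "connection \<Rightarrow> tensor11 \<Rightarrow> vfield \<Rightarrow> vfield \<Rightarrow> vfield" where
  "composition_tensor \<D> f X Y = smul (\<lambda>_. 1 / 4)
     (app f (cov_deriv11 \<D> f (app f X) (app f Y)
           - cov_deriv11 \<D> f (app f (app f X)) (app f (app f Y))))"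

text \<open>The Levi-Civita connection of a Riemannian metric is unique on smooth vector fields; its values
  elsewhere are irrelevant, so it is quantified over.\<close>

definition hermitian_f_structure :: "tensor02 \<Rightarrow> tensor11 \<Rightarrow> bool" where
  "hermitian_f_structure g f \<longleftrightarrow> metric_f_structure g f \<and>
     (\<forall>\<D>. levi_civita g \<D> \<longrightarrow>
        (\<forall>X\<in>vector_fields. \<forall>Y\<in>vector_fields. composition_tensor \<D> f X Y = 0))"


subsection \<open>Invariant metrics and invariant f-structures\<close>

text \<open>Invariant tensor fields are given at the origin in terms of \<open>\<mm>\<close> and transported to \<open>p\<close> by an
  element \<open>g\<close> with \<open>act g origin = p\<close>. All choices of \<open>g\<close> give the same result, since the tensors
  at the origin are invariant under conjugation by \<open>Tmax\<close>.\<close>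

definition frame :: "flag \<Rightarrow> cmat" where
  "frame p = (SOME g. g \<in> SU3 \<and> act g origin = p)"

definition coord :: "flag \<Rightarrow> tangent \<Rightarrow> cmat" where
  "coord p v = (THE A. A \<in> \<mm> \<and> v = push (frame p) (at_origin A))"

text \<open>The parameters \<open>a\<close>, \<open>b\<close>, \<open>c\<close> of \<open>matD a b c\<close>.\<close>

definition param_a :: "cmat \<Rightarrow> complex" where "param_a A = A $ 1 $ 2"
definition param_b :: "cmat \<Rightarrow> complex" where "param_b A = A $ 2 $ 3"
definition param_c :: "cmat \<Rightarrow> complex" where "param_c A = - (A $ 3 $ 1)"

definition ip_origin :: "cmat \<Rightarrow> cmat \<Rightarrow> real" where
  "ip_origin A B = - (1 / 2) * Re (trace (A ** B))"

definition metric_origin :: "real \<Rightarrow> real \<Rightarrow> real \<Rightarrow> cmat \<Rightarrow> cmat \<Rightarrow> real" where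
  "metric_origin l1 l2 l3 A B =
     l1 * ip_origin (matD (param_a A) 0 0) (matD (param_a B) 0 0) +
     l2 * ip_origin (matD 0 (param_b A) 0) (matD 0 (param_b B) 0) +
     l3 * ip_origin (matD 0 0 (param_c A)) (matD 0 0 (param_c B))"

definition f_origin :: "real \<Rightarrow> real \<Rightarrow> real \<Rightarrow> cmat \<Rightarrow> cmat" where
  "f_origin z1 z2 z3 A =
     matD (of_real z1 * \<i> * param_a A) (of_real z2 * \<i> * param_b A) (of_real z3 * \<i> * param_c A)"

definition inv_metric :: "real \<Rightarrow> real \<Rightarrow> real \<Rightarrow> tensor02" where
  "inv_metric l1 l2 l3 p v w = metric_origin l1 l2 l3 (coord p v) (coord p w)"

definition inv_f :: "real \<Rightarrow> real \<Rightarrow> real \<Rightarrow> tensor11" where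
  "inv_f z1 z2 z3 p v = push (frame p) (at_origin (f_origin z1 z2 z3 (coord p v)))"

end

theory Submission
  imports Defs
begin

text \<open>
  A vector field \<open>X\<close> on the flag manifold lifts to a smooth function \<open>x\<close> from \<open>SU3\<close> to \<open>\<mm>\<close>, where
  \<open>X\<close> at \<open>g T\<close> is the velocity of \<open>g exp (\<tau> x(g)) T\<close>. The entries of the projections \<open>g E\<^sub>k\<^sub>k g\<^sup>*\<close>
  descend to functions on the flag manifold whose derivative along \<open>X\<close> is \<open>g [x, E\<^sub>k\<^sub>k] g\<^sup>*\<close>, and these
  determine \<open>x\<close>. Applying them to \<open>[X, Y]\<close>, the Jacobi identity gives the lift
  \<open>D\<^sub>x y - D\<^sub>y x + [x, y]\<^sub>\<mm>\<close> of the bracket, so the lift of the Levi-Civita derivative is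
  \<open>D\<^sub>x y + \<Lambda>(x, y)\<close>, where the Koszul formula expresses \<open>2 g(\<Lambda>(x, y), z)\<close> by the \<open>\<mm>\<close>-components of
  brackets. Since an invariant f-structure is a constant linear map on the lifts, the derivative terms
  cancel in the composition tensor \<open>T\<close>, and \<open>g(T, Z)\<close> becomes a trilinear form in \<open>x\<close>, \<open>y\<close>, \<open>z\<close>. It
  pairs the \<open>(0,1)\<close>-part of brackets of \<open>(1,0)\<close>-vectors, and can be nonzero only if all three
  \<open>\<zeta>\<^sub>j\<close> are nonzero and equal. Taking \<open>Z = T\<close> gives \<open>T = 0\<close>.
\<close>

subsection \<open>Smooth functions\<close>

lemma frechet_derivative_eqI:
  assumes "(F has_derivative F') (at x)"
  shows "frechet_derivative F (at x) = F'"
  using frechet_derivative_at[OF assms] by simp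

lemma has_derivative_frechet:
  "F differentiable (at x) \<Longrightarrow> (F has_derivative frechet_derivative F (at x)) (at x)"
  by (simp add: frechet_derivative_works)

lemma frechet_derivative_cong_open:
  assumes "open U" "x \<in> U" "\<And>y. y \<in> U \<Longrightarrow> F y = G y"
  shows "frechet_derivative F (at x) = frechet_derivative G (at x)"
proof -
  \<comment> \<open>\<open>frechet_derivative\<close> is chosen from this predicate, so equal
    predicates give equal values even where no derivative exists.\<close>
  have "(F has_derivative D) (at x) = (G has_derivative D) (at x)" for D
    using assms by (auto intro: has_derivative_transform_within_open[of _ _ x UNIV U])
  then show ?thesis
    unfolding frechet_derivative_def by simp
qed

lemma Ck_on_cong:
  assumes "open U" "\<And>x. x \<in> U \<Longrightarrow> F x = G x"
  shows "Ck_on k U F = Ck_on k U G"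
  using assms(2)
proof (induction k arbitrary: F G)
  case 0
  then show ?case by (simp cong: continuous_on_cong)
next
  case (Suc k)
  have d: "(F differentiable (at x)) = (G differentiable (at x))" if "x \<in> U" for x
    unfolding differentiable_def
    using has_derivative_transform_within_open[of _ _ x UNIV U] assms(1) that Suc.prems by metis
  have e: "Ck_on k U (\<lambda>x. frechet_derivative F (at x) v) = Ck_on k U (\<lambda>x. frechet_derivative G (at x) v)" for v
    by (rule Suc.IH) (simp add: frechet_derivative_cong_open[OF assms(1) _ Suc.prems])
  show ?case using d e by auto
qed

lemma Ck_on_subset: "Ck_on k U F \<Longrightarrow> V \<subseteq> U \<Longrightarrow> Ck_on k V F"
  by (induction k arbitrary: F) (auto intro: continuous_on_subset)

lemma Ck_on_continuous: "Ck_on k U F \<Longrightarrow> continuous_on U F"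
  by (cases k) (simp_all add: continuous_at_imp_continuous_on differentiable_imp_continuous_within)

lemma Ck_on_Suc_imp: "Ck_on (Suc k) U F \<Longrightarrow> Ck_on k U F"
proof (induction k arbitrary: F)
  case 0
  then show ?case using Ck_on_continuous[of "Suc 0" U F] by simp
next
  case (Suc k)
  then show ?case by (metis Ck_on.simps(2))
qed

lemma Ck_on_const: "Ck_on k U (\<lambda>x. c)"
  by (induction k arbitrary: c) (auto simp: frechet_derivative_const)

text \<open>A linear inner map only turns the direction \<open>v\<close> into \<open>L v\<close>, so
  the derivative of the composition has the same form and the induction closes. Left translation by
  a matrix is the case used later.\<close>

lemma Ck_on_compose_linear:
  assumes "bounded_linear L" "open V" "L ` V \<subseteq> U" "Ck_on k U F"
  shows "Ck_on k V (\<lambda>x. F (L x))"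
  using assms(4)
proof (induction k arbitrary: F)
  case 0
  then show ?case
    using assms(3) continuous_on_compose2[of U F V L] linear_continuous_on[OF assms(1)] by auto
next
  case (Suc k)
  have d: "((\<lambda>x. F (L x)) has_derivative (\<lambda>v. frechet_derivative F (at (L x)) (L v))) (at x)"
    if "x \<in> V" for x
  proof -
    have "L x \<in> U" using that assms(3) by auto
    then have "(F has_derivative frechet_derivative F (at (L x))) (at (L x))"
      using Suc.prems by (simp add: has_derivative_frechet)
    from has_derivative_compose[OF bounded_linear_imp_has_derivative[OF assms(1)] this]
    show ?thesis .
  qed
  have "Ck_on k V (\<lambda>x. frechet_derivative (\<lambda>x. F (L x)) (at x) v)" for v
  proof -
    have "Ck_on k V (\<lambda>x. frechet_derivative F (at (L x)) (L v))"
      by (rule Suc.IH) (use Suc.prems in simp)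
    then show ?thesis
      by (subst Ck_on_cong[OF assms(2), where G = "\<lambda>x. frechet_derivative F (at (L x)) (L v)"])
        (auto simp: frechet_derivative_eqI[OF d])
  qed
  then show ?case using d by (auto simp: differentiable_def)
qed

lemma Ck_on_add:
  assumes "open U" "Ck_on k U F" "Ck_on k U G"
  shows "Ck_on k U (\<lambda>x. F x + G x)"
  using assms(2,3)
proof (induction k arbitrary: F G)
  case 0
  then show ?case by (auto intro: continuous_intros)
next
  case (Suc k)
  have d: "((\<lambda>x. F x + G x) has_derivative
      (\<lambda>v. frechet_derivative F (at x) v + frechet_derivative G (at x) v)) (at x)" if "x \<in> U" for x
    using Suc.prems that by (auto intro!: has_derivative_add has_derivative_frechet)
  have "Ck_on k U (\<lambda>x. frechet_derivative (\<lambda>x. F x + G x) (at x) v)" for v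
  proof -
    have "Ck_on k U (\<lambda>x. frechet_derivative F (at x) v + frechet_derivative G (at x) v)"
      by (rule Suc.IH) (use Suc.prems in auto)
    then show ?thesis
      by (subst Ck_on_cong[OF assms(1), where G = "\<lambda>x. frechet_derivative F (at x) v + frechet_derivative G (at x) v"])
        (auto simp: frechet_derivative_eqI[OF d])
  qed
  then show ?case using d by (auto simp: differentiable_def)
qed

text \<open>The product rule gives two terms of the same bilinear shape. In each, one factor loses a
  degree and \<open>Ck_on_Suc_imp\<close> lowers the other.\<close>

lemma Ck_on_bilinear:
  assumes "bounded_bilinear B" "open U" "Ck_on k U F" "Ck_on k U G"
  shows "Ck_on k U (\<lambda>x. B (F x) (G x))"
  using assms(3,4)
proof (induction k arbitrary: F G)
  case 0
  then show ?case
    using bounded_bilinear.continuous_on[OF assms(1)] by auto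
next
  case (Suc k)
  let ?D = "\<lambda>x v. B (F x) (frechet_derivative G (at x) v) + B (frechet_derivative F (at x) v) (G x)"
  have d: "((\<lambda>x. B (F x) (G x)) has_derivative ?D x) (at x)" if "x \<in> U" for x
    using Suc.prems that
    by (auto intro!: bounded_bilinear.FDERIV[OF assms(1)] has_derivative_frechet)
  have "Ck_on k U (\<lambda>x. frechet_derivative (\<lambda>x. B (F x) (G x)) (at x) v)" for v
  proof -
    have "Ck_on k U (\<lambda>x. ?D x v)"
      by (intro Ck_on_add assms Suc.IH) (use Suc.prems Ck_on_Suc_imp in auto)
    then show ?thesis
      by (subst Ck_on_cong[OF assms(2), where G = "\<lambda>x. ?D x v"])
        (auto simp: frechet_derivative_eqI[OF d])
  qed
  then show ?case using d by (auto simp: differentiable_def)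
qed

lemma Ck_on_id: "open U \<Longrightarrow> Ck_on k U (\<lambda>x. x)"
  by (cases k) (auto simp: Ck_on_const)

text \<open>With the constant scalar 1 as first factor, closure under linear maps becomes a case of
  closure under bilinear ones.\<close>

lemma bounded_bilinear_linear_snd:
  "bounded_linear L \<Longrightarrow> bounded_bilinear (\<lambda>(r::real) x. r *\<^sub>R L x)"
  using bounded_bilinear.comp[OF bounded_bilinear_scaleR bounded_linear_ident, of L] by simp

lemma Ck_on_linear:
  assumes "bounded_linear L" "open U" "Ck_on k U F"
  shows "Ck_on k U (\<lambda>x. L (F x))"
  using Ck_on_bilinear[OF bounded_bilinear_linear_snd[OF assms(1)] assms(2) Ck_on_const[of k U 1] assms(3)]
  by simp

lemma smooth_on_open_subset:
  "smooth_on_open U F \<Longrightarrow> open V \<Longrightarrow> V \<subseteq> U \<Longrightarrow> smooth_on_open V F"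
  by (auto simp: smooth_on_open_def intro: Ck_on_subset)

lemma smooth_on_open_derivative:
  "smooth_on_open U F \<Longrightarrow> smooth_on_open U (\<lambda>x. frechet_derivative F (at x) v)"
  unfolding smooth_on_open_def using Ck_on.simps(2) by blast

lemma smooth_on_open_bilinear:
  "bounded_bilinear B \<Longrightarrow> smooth_on_open U F \<Longrightarrow> smooth_on_open U G \<Longrightarrow>
    smooth_on_open U (\<lambda>x. B (F x) (G x))"
  unfolding smooth_on_open_def using Ck_on_bilinear by blast

lemma smooth_on_open_linear:
  "bounded_linear L \<Longrightarrow> smooth_on_open U F \<Longrightarrow> smooth_on_open U (\<lambda>x. L (F x))"
  unfolding smooth_on_open_def using Ck_on_linear by blast

lemma smooth_on_open_add:
  "smooth_on_open U F \<Longrightarrow> smooth_on_open U G \<Longrightarrow> smooth_on_open U (\<lambda>x. F x + G x)"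
  unfolding smooth_on_open_def using Ck_on_add by blast

lemma smooth_on_open_sum:
  "finite I \<Longrightarrow> open U \<Longrightarrow> (\<And>i. i \<in> I \<Longrightarrow> smooth_on_open U (F i)) \<Longrightarrow>
    smooth_on_open U (\<lambda>x. \<Sum>i\<in>I. F i x)"
  by (induction I rule: finite_induct)
    (auto intro!: smooth_on_open_add, auto simp: smooth_on_open_def Ck_on_const)

lemma smooth_on_open_id: "open U \<Longrightarrow> smooth_on_open U (\<lambda>x. x)"
  by (auto simp: smooth_on_open_def Ck_on_id)

lemma smooth_on_open_const: "open U \<Longrightarrow> smooth_on_open U (\<lambda>x. c)"
  by (auto simp: smooth_on_open_def Ck_on_const)

lemma smooth_on_open_differentiable:
  "smooth_on_open U F \<Longrightarrow> x \<in> U \<Longrightarrow> F differentiable (at x)"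
  unfolding smooth_on_open_def using Ck_on.simps(2) by blast

section \<open>Smooth functions on \<open>SU3\<close> with values in a normed space\<close>

definition smoothG :: "(cmat \<Rightarrow> 'b::real_normed_vector) \<Rightarrow> bool" where
  "smoothG F \<longleftrightarrow>
     (\<forall>g\<in>SU3. \<exists>U E. g \<in> U \<and> smooth_on_open U E \<and> (\<forall>x \<in> U \<inter> SU3. E x = F x))"

lemma smoothG_real: "smooth_on_SU3 F = smoothG F"
  by (simp add: smooth_on_SU3_def smoothG_def)

lemma smoothG_cong: "(\<And>x. x \<in> SU3 \<Longrightarrow> F x = G x) \<Longrightarrow> smoothG F = smoothG G"
  by (simp add: smoothG_def)

lemma smoothG_const: "smoothG (\<lambda>x. c)"
  unfolding smoothG_def by (auto intro!: exI[of _ UNIV] exI[of _ "\<lambda>x. c"] smooth_on_open_const)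

lemma smoothG_id: "smoothG (\<lambda>x. x)"
  unfolding smoothG_def by (auto intro!: exI[of _ UNIV] exI[of _ "\<lambda>x. x"] smooth_on_open_id)

lemma smoothG_linear:
  assumes "bounded_linear L" "smoothG F"
  shows "smoothG (\<lambda>x. L (F x))"
  unfolding smoothG_def
proof
  fix g assume "g \<in> SU3"
  then obtain U E where "g \<in> U" "smooth_on_open U E" "\<forall>x \<in> U \<inter> SU3. E x = F x"
    using assms(2) unfolding smoothG_def by blast
  then show "\<exists>U E. g \<in> U \<and> smooth_on_open U E \<and> (\<forall>x\<in>U \<inter> SU3. E x = L (F x))"
    using smooth_on_open_linear[OF assms(1), of U E]
    by (intro exI[of _ U] exI[of _ "\<lambda>x. L (E x)"]) auto
qed

lemma smoothG_bilinear:
  assumes "bounded_bilinear B" "smoothG F" "smoothG G"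
  shows "smoothG (\<lambda>x. B (F x) (G x))"
  unfolding smoothG_def
proof
  fix g assume g: "g \<in> SU3"
  obtain U E where U: "g \<in> U" "smooth_on_open U E" "\<forall>x \<in> U \<inter> SU3. E x = F x"
    using assms(2) g unfolding smoothG_def by blast
  obtain V H where V: "g \<in> V" "smooth_on_open V H" "\<forall>x \<in> V \<inter> SU3. H x = G x"
    using assms(3) g unfolding smoothG_def by blast
  have "open (U \<inter> V)" using U V by (auto simp: smooth_on_open_def)
  then have "smooth_on_open (U \<inter> V) (\<lambda>x. B (E x) (H x))"
    by (intro smooth_on_open_bilinear[OF assms(1)])
      (use U V in \<open>auto elim: smooth_on_open_subset\<close>)
  then show "\<exists>U E. g \<in> U \<and> smooth_on_open U E \<and> (\<forall>x\<in>U \<inter> SU3. E x = B (F x) (G x))"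
    using U V by (intro exI[of _ "U \<inter> V"] exI[of _ "\<lambda>x. B (E x) (H x)"]) auto
qed

lemma smoothG_add:
  assumes "smoothG F" "smoothG G"
  shows "smoothG (\<lambda>x. F x + G x)"
  unfolding smoothG_def
proof
  fix g assume g: "g \<in> SU3"
  obtain U E where U: "g \<in> U" "smooth_on_open U E" "\<forall>x \<in> U \<inter> SU3. E x = F x"
    using assms(1) g unfolding smoothG_def by blast
  obtain V H where V: "g \<in> V" "smooth_on_open V H" "\<forall>x \<in> V \<inter> SU3. H x = G x"
    using assms(2) g unfolding smoothG_def by blast
  have "open (U \<inter> V)" using U V by (auto simp: smooth_on_open_def)
  then have "smooth_on_open (U \<inter> V) (\<lambda>x. E x + H x)"
    by (intro smooth_on_open_add)
      (use U V in \<open>auto elim: smooth_on_open_subset\<close>)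
  then show "\<exists>U E. g \<in> U \<and> smooth_on_open U E \<and> (\<forall>x\<in>U \<inter> SU3. E x = F x + G x)"
    using U V by (intro exI[of _ "U \<inter> V"] exI[of _ "\<lambda>x. E x + H x"]) auto
qed

lemma smoothG_sum:
  "finite I \<Longrightarrow> (\<And>i. i \<in> I \<Longrightarrow> smoothG (F i)) \<Longrightarrow> smoothG (\<lambda>x. \<Sum>i\<in>I. F i x)"
  by (induction I rule: finite_induct) (auto intro!: smoothG_add smoothG_const)

text \<open>Reduces matrix-valued functions to real coordinates, the form in which vector fields
  supply smoothness, since they act on real functions.\<close>

lemma smoothG_euclidean:
  fixes F :: "cmat \<Rightarrow> 'b::euclidean_space"
  assumes "\<And>b. smoothG (\<lambda>x. F x \<bullet> b)"
  shows "smoothG F"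
proof -
  have "smoothG (\<lambda>x. \<Sum>b\<in>Basis. (F x \<bullet> b) *\<^sub>R b)"
    by (intro smoothG_sum finite_Basis smoothG_linear[OF bounded_linear_scaleR_left] assms)
  then show ?thesis by (simp add: euclidean_representation)
qed

text \<open>\<open>L\<close> stands for the differential of \<open>F\<close> at \<open>g\<close>. It
  is defined on all matrices but constrained only on velocities of curves in \<open>SU3\<close>,
  because local extensions of \<open>F\<close> are not unique.\<close>

definition curve_derivative :: "(cmat \<Rightarrow> 'b::real_normed_vector) \<Rightarrow> cmat \<Rightarrow> (cmat \<Rightarrow> 'b) \<Rightarrow> bool" where
  "curve_derivative F g L \<longleftrightarrow> linear L \<and>
    (\<forall>c V. c (0::real) = g \<longrightarrow> (\<forall>\<tau>. c \<tau> \<in> SU3) \<longrightarrow> (c has_vector_derivative V) (at 0) \<longrightarrow>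
      ((\<lambda>\<tau>. F (c \<tau>)) has_vector_derivative L V) (at 0))"

lemma curve_derivativeD:
  "curve_derivative F g L \<Longrightarrow> c 0 = g \<Longrightarrow> (\<And>\<tau>. c \<tau> \<in> SU3) \<Longrightarrow> (c has_vector_derivative V) (at 0) \<Longrightarrow>
      ((\<lambda>\<tau>. F (c \<tau>)) has_vector_derivative L V) (at 0)"
  by (simp add: curve_derivative_def)

lemma curve_derivative_extension:
  assumes "g \<in> U" "smooth_on_open U E" "\<forall>x \<in> U \<inter> SU3. E x = F x"
  shows "curve_derivative F g (frechet_derivative E (at g))"
  unfolding curve_derivative_def
proof (intro conjI allI impI)
  have E: "(E has_derivative frechet_derivative E (at g)) (at g)"
    using assms by (intro has_derivative_frechet smooth_on_open_differentiable[of U])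
  then show "linear (frechet_derivative E (at g))"
    by (rule has_derivative_linear)
  fix c :: "real \<Rightarrow> cmat" and V
  assume c: "c 0 = g" "\<forall>\<tau>. c \<tau> \<in> SU3" and d: "(c has_vector_derivative V) (at 0)"
  have 1: "((\<lambda>\<tau>. E (c \<tau>)) has_vector_derivative frechet_derivative E (at g) V) (at 0)"
    using vector_derivative_diff_chain_within[OF d, of E "frechet_derivative E (at g)"] E c(1)
    by (auto simp: o_def intro: has_derivative_at_withinI)
  \<comment> \<open>Continuity keeps the curve inside \<open>U\<close> near time 0, where
    \<open>E\<close> and \<open>F\<close> agree along it.\<close>
  have "isCont c 0" using d has_vector_derivative_continuous by blast
  moreover have "open U" using assms(2) by (simp add: smooth_on_open_def)
  ultimately obtain S where "open S" "(0::real) \<in> S" "\<forall>\<tau>\<in>S. c \<tau> \<in> U"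
    using assms(1) c(1) unfolding continuous_at_open by metis
  then show "((\<lambda>\<tau>. F (c \<tau>)) has_vector_derivative frechet_derivative E (at g) V) (at 0)"
    using has_vector_derivative_transform_within_open[OF 1, of S] assms(3) c(2) by auto
qed

lemma smoothG_curve_derivative:
  assumes "smoothG F" "g \<in> SU3"
  obtains L where "curve_derivative F g L"
  using assms curve_derivative_extension[of g _ _ F] unfolding smoothG_def by blast

section \<open>Matrix algebra and the group \<open>SU3\<close>\<close>

lemma matrix_add_rdistrib: "(A + B) ** C = A ** C + B ** (C::cmat)"
  by (simp add: matrix_matrix_mult_def vec_eq_iff distrib_right sum.distrib)

lemma matrix_scaleR_left: "(r *\<^sub>R A) ** B = r *\<^sub>R (A ** (B::cmat))"
  by (simp add: matrix_matrix_mult_def vec_eq_iff scaleR_sum_right)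

lemma matrix_scaleR_right: "A ** (r *\<^sub>R B) = r *\<^sub>R (A ** (B::cmat))"
  by (simp add: matrix_matrix_mult_def vec_eq_iff scaleR_sum_right)

lemma bounded_bilinear_matrix_mult: "bounded_bilinear ((**) :: cmat \<Rightarrow> cmat \<Rightarrow> cmat)"
  unfolding bilinear_conv_bounded_bilinear[symmetric] bilinear_def
  by (auto intro!: linearI simp: matrix_add_ldistrib matrix_add_rdistrib matrix_scaleR_left matrix_scaleR_right)

lemmas matrix_diff_left = bounded_bilinear.diff_left[OF bounded_bilinear_matrix_mult]
  and matrix_diff_right = bounded_bilinear.diff_right[OF bounded_bilinear_matrix_mult]
  and matrix_add_right = bounded_bilinear.add_right[OF bounded_bilinear_matrix_mult]
  and matrix_add_left = bounded_bilinear.add_left[OF bounded_bilinear_matrix_mult]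
  and matrix_minus_left = bounded_bilinear.minus_left[OF bounded_bilinear_matrix_mult]
  and matrix_minus_right = bounded_bilinear.minus_right[OF bounded_bilinear_matrix_mult]

lemma linear_adj: "linear adj"
  by (rule linearI) (simp_all add: adj_def vec_eq_iff)

lemma bounded_linear_adj: "bounded_linear adj"
  using linear_adj linear_conv_bounded_linear by blast

lemma adj_adj [simp]: "adj (adj A) = A"
  by (simp add: adj_def vec_eq_iff)

lemma adj_mult: "adj (A ** B) = adj B ** adj A"
  by (simp add: adj_def vec_eq_iff matrix_matrix_mult_def mult.commute)

lemma adj_one [simp]: "adj (mat 1) = mat 1"
  by (auto simp: adj_def mat_def vec_eq_iff)

lemma det_adj: "det (adj A) = cnj (det A)"
  by (simp add: det_3 adj_def algebra_simps)

lemma SU3_iff: "A \<in> SU3 \<longleftrightarrow> A ** adj A = mat 1 \<and> adj A ** A = mat 1 \<and> det A = 1"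
  unfolding SU3_def using matrix_left_right_inverse by auto

lemma SU3_mult: "A \<in> SU3 \<Longrightarrow> B \<in> SU3 \<Longrightarrow> A ** B \<in> SU3"
  unfolding SU3_def
  by (simp add: adj_mult det_mul) (metis matrix_mul_assoc matrix_mul_rid)

lemma SU3_adj: "A \<in> SU3 \<Longrightarrow> adj A \<in> SU3"
  by (simp add: SU3_iff det_adj)

lemma SU3_one: "mat 1 \<in> SU3"
  by (simp add: SU3_def)

lemma SU3_cancel:
  assumes "A \<in> SU3"
  shows "adj A ** (A ** B) = B" "A ** (adj A ** B) = B" "(B ** A) ** adj A = B" "(B ** adj A) ** A = B"
  using assms by (simp_all add: SU3_iff matrix_mul_assoc) (simp_all add: matrix_mul_assoc[symmetric])

subsection \<open>The matrix exponential\<close>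

abbreviation mpow :: "cmat \<Rightarrow> nat \<Rightarrow> cmat" where
  "mpow A n \<equiv> ((**) A ^^ n) (mat 1)"

lemma mpow_scaleR: "mpow (r *\<^sub>R A) n = r ^ n *\<^sub>R mpow A n"
  by (induction n) (simp_all add: matrix_scaleR_left matrix_scaleR_right)

text \<open>Take \<open>K = norm A * C\<close>, where \<open>C\<close> is the constant bounding the
  bilinear matrix product. A geometric bound suffices against the factorials.\<close>

lemma mpow_norm_bound: "\<exists>K. \<forall>n. norm (mpow A n) \<le> K ^ n * norm (mat 1 :: cmat)"
proof -
  obtain C where C: "\<And>(A::cmat) (B::cmat). norm (A ** B) \<le> norm A * norm B * C" "C > 0"
    using bounded_bilinear.pos_bounded[OF bounded_bilinear_matrix_mult] by metis
  have "norm (mpow A n) \<le> (norm A * C) ^ n * norm (mat 1 :: cmat)" for n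
  proof (induction n)
    case (Suc n)
    have "norm (mpow A (Suc n)) \<le> (norm A * C) * norm (mpow A n)"
      using C(1)[of A "mpow A n"] by (simp add: mult_ac)
    also have "\<dots> \<le> (norm A * C) * ((norm A * C) ^ n * norm (mat 1 :: cmat))"
      by (intro mult_left_mono Suc.IH) (use C(2) in auto)
    finally show ?case by (simp add: mult_ac)
  qed simp
  then show ?thesis by blast
qed

lemma summable_mpow: "summable (\<lambda>n. (1 / fact n) *\<^sub>R mpow A n)"
proof -
  obtain K where K: "\<And>n. norm (mpow A n) \<le> K ^ n * norm (mat 1 :: cmat)"
    using mpow_norm_bound by blast
  have "summable (\<lambda>n. inverse (fact n) * K ^ n * norm (mat 1 :: cmat))"
    by (intro summable_mult2 summable_exp)
  then show ?thesis
    by (rule summable_comparison_test'[where N = 0])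
      (use K in \<open>simp add: divide_simps\<close>)
qed

text \<open>Each entry of the exponential is a scalar power series with these coefficients, so
  termwise differentiation of complex power series applies.\<close>

definition mexp_coeff :: "cmat \<Rightarrow> 3 \<Rightarrow> 3 \<Rightarrow> nat \<Rightarrow> complex" where
  "mexp_coeff A i j n = mpow A n $ i $ j / fact n"

lemma mexp_entry: "(\<lambda>n. mexp_coeff A i j n * of_real \<tau> ^ n) sums (mexp (\<tau> *\<^sub>R A) $ i $ j)"
proof -
  have L: "bounded_linear (\<lambda>M::cmat. M $ i $ j)"
    using bounded_linear_compose[OF bounded_linear_vec_nth[of j] bounded_linear_vec_nth[of i]] .
  have "(\<lambda>n. ((1 / fact n) *\<^sub>R mpow (\<tau> *\<^sub>R A) n) $ i $ j) sums (mexp (\<tau> *\<^sub>R A) $ i $ j)"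
    unfolding mexp_def
    by (intro bounded_linear.sums[OF L] summable_sums summable_mpow)
  then show ?thesis
    unfolding mpow_scaleR mexp_coeff_def
    by (simp add: scaleR_conv_of_real[where 'a = complex] mult_ac)
qed

lemma summable_mexp_coeff: "summable (\<lambda>n. mexp_coeff A i j n * z ^ n)"
proof -
  \<comment> \<open>Convergence at a real point of modulus larger than that of \<open>z\<close>
    implies convergence at \<open>z\<close>.\<close>
  have "summable (\<lambda>n. mexp_coeff A i j n * of_real (norm z + 1) ^ n)"
    using mexp_entry sums_summable by blast
  then show ?thesis
    by (rule powser_inside) (simp del: of_real_add)
qed

text \<open>The equation \<open>e' = A e\<close> on coefficients: \<open>diffs\<close> shifts the
  index and cancels one factor of the factorial, and one \<open>A\<close> splits off the
  power.\<close>

lemma mexp_coeff_diffs: "diffs (mexp_coeff A i j) n = (\<Sum>k\<in>UNIV. A $ i $ k * mexp_coeff A k j n)"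
proof -
  have "diffs (mexp_coeff A i j) n = mpow A (Suc n) $ i $ j / fact n"
    unfolding diffs_def mexp_coeff_def fact_Suc by (simp del: of_nat_Suc)
  then show ?thesis
    by (simp add: mexp_coeff_def matrix_matrix_mult_def sum_divide_distrib)
qed

lemma mexp_entry_deriv:
  "((\<lambda>\<tau>. mexp (\<tau> *\<^sub>R A) $ i $ j) has_vector_derivative (A ** mexp (\<tau> *\<^sub>R A)) $ i $ j) (at \<tau>)"
proof -
  have "((\<lambda>z. \<Sum>n. mexp_coeff A i j n * z ^ n) has_field_derivative
      (\<Sum>n. diffs (mexp_coeff A i j) n * of_real \<tau> ^ n)) (at (of_real \<tau>))"
    by (intro termdiffs_strong_converges_everywhere summable_mexp_coeff)
  then have "((\<lambda>z. \<Sum>n. mexp_coeff A i j n * of_real z ^ n) has_vector_derivative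
      (\<Sum>n. diffs (mexp_coeff A i j) n * of_real \<tau> ^ n)) (at \<tau>)"
    by (rule has_vector_derivative_real_field)
  moreover have "(\<lambda>n. diffs (mexp_coeff A i j) n * of_real \<tau> ^ n) sums (A ** mexp (\<tau> *\<^sub>R A)) $ i $ j"
    unfolding mexp_coeff_diffs sum_distrib_right matrix_matrix_mult_def
    by (simp add: mult.assoc) (intro sums_sum sums_mult mexp_entry)
  ultimately show ?thesis
    using mexp_entry by (simp add: sums_iff)
qed

text \<open>Used twice in succession, for the rows and then for their entries, to pass from entries
  to the whole matrix.\<close>

lemma has_vector_derivative_vec:
  fixes f :: "real \<Rightarrow> 'a::euclidean_space ^ 'n"
  assumes "\<And>i. ((\<lambda>x. f x $ i) has_vector_derivative f' $ i) (at x)"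
  shows "(f has_vector_derivative f') (at x)"
proof -
  have "((\<lambda>x. f x \<bullet> b) has_derivative (\<lambda>h. (h *\<^sub>R f') \<bullet> b)) (at x)" if "b \<in> Basis" for b
  proof -
    obtain i u where b: "b = axis i u"
      using \<open>b \<in> Basis\<close> unfolding Basis_vec_def by auto
    show ?thesis
      using has_derivative_inner_left[OF assms[of i, unfolded has_vector_derivative_def], of u]
      by (simp add: b inner_axis)
  qed
  then show ?thesis
    unfolding has_vector_derivative_def by (subst has_derivative_componentwise_within) auto
qed

lemma mexp_deriv:
  "((\<lambda>\<tau>. mexp (\<tau> *\<^sub>R A)) has_vector_derivative A ** mexp (\<tau> *\<^sub>R A)) (at \<tau>)"
  by (intro has_vector_derivative_vec mexp_entry_deriv)

lemma mexp_zero [simp]: "mexp 0 = mat 1"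
proof -
  have "(\<lambda>n. (1 / fact n) *\<^sub>R mpow 0 n) = (\<lambda>n. if n = 0 then mat 1 else 0)"
  proof
    fix n show "(1 / fact n) *\<^sub>R mpow 0 n = (if n = 0 then mat 1 else (0::cmat))"
      by (cases n) (simp_all add: matrix_matrix_mult_def vec_eq_iff)
  qed
  then show ?thesis
    unfolding mexp_def using suminf_finite[of "{0}" "\<lambda>n. if n = 0 then mat 1 else (0::cmat)"] by simp
qed

text \<open>Both \<open>e\<^sup>* e\<close> and \<open>det e\<close> are constant along \<open>e = exp (\<tau> A)\<close> because \<open>e' = A e\<close>.\<close>

lemma mexp_SU3:
  assumes "adj A = - A" "trace A = 0"
  shows "mexp (\<tau> *\<^sub>R A) \<in> SU3"
proof -
  let ?e = "\<lambda>\<tau>. mexp (\<tau> *\<^sub>R A)"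
  have "((\<lambda>\<tau>. adj (?e \<tau>) ** ?e \<tau>) has_vector_derivative
      adj (?e \<tau>) ** (A ** ?e \<tau>) + adj (A ** ?e \<tau>) ** ?e \<tau>) (at \<tau>)" for \<tau>
    by (intro bounded_bilinear.has_vector_derivative[OF bounded_bilinear_matrix_mult]
        bounded_linear.has_vector_derivative[OF bounded_linear_adj] mexp_deriv)
  then have "((\<lambda>\<tau>. adj (?e \<tau>) ** ?e \<tau>) has_vector_derivative 0) (at \<tau>)" for \<tau>
    by (simp add: adj_mult assms matrix_mul_assoc matrix_minus_left matrix_minus_right)
  then obtain C where "\<And>\<tau>. adj (?e \<tau>) ** ?e \<tau> = C"
    using has_vector_derivative_zero_constant[of UNIV "\<lambda>\<tau>. adj (?e \<tau>) ** ?e \<tau>"] by auto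
  from this[of \<tau>] this[of 0] have 1: "adj (?e \<tau>) ** ?e \<tau> = mat 1" by simp
  have d: "((\<lambda>\<tau>. ?e \<tau> $ i $ j) has_vector_derivative (\<Sum>k\<in>UNIV. A $ i $ k * ?e \<tau> $ k $ j)) (at \<tau>)" for i j \<tau>
    using mexp_entry_deriv[of A i j \<tau>] by (simp add: matrix_matrix_mult_def)
  have t: "A $ 3 $ 3 = - A $ 1 $ 1 - A $ 2 $ 2"
    using assms(2) by (simp add: trace_def sum_3 algebra_simps add_eq_0_iff)
  have "((\<lambda>\<tau>. det (?e \<tau>)) has_vector_derivative 0) (at \<tau>)" for \<tau>
    unfolding det_3
    by (rule has_vector_derivative_eq_rhs) ((rule derivative_intros d)+, simp add: sum_3 t algebra_simps)
  then obtain C where "\<And>\<tau>. det (?e \<tau>) = C"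
    using has_vector_derivative_zero_constant[of UNIV "\<lambda>\<tau>. det (?e \<tau>)"] by auto
  from this[of \<tau>] this[of 0] have "det (?e \<tau>) = 1" by simp
  with 1 show ?thesis
    unfolding SU3_def using matrix_left_right_inverse by auto
qed

subsection \<open>The flag manifold\<close>

lemma Tmax_SU3: "h \<in> Tmax \<Longrightarrow> h \<in> SU3"
  by (simp add: Tmax_def)

lemma Tmax_one: "mat 1 \<in> Tmax"
  using SU3_one by (simp add: Tmax_def) (simp add: mat_def)

lemma Tmax_mult: "h \<in> Tmax \<Longrightarrow> k \<in> Tmax \<Longrightarrow> h ** k \<in> Tmax"
  by (simp add: Tmax_def SU3_mult)
    (simp add: matrix_matrix_mult_def sum_3 forall_3)

lemma Tmax_adj: "h \<in> Tmax \<Longrightarrow> adj h \<in> Tmax"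
  unfolding Tmax_def using SU3_adj by (auto simp: adj_def)

lemma coset_mult_Tmax:
  assumes "h \<in> Tmax"
  shows "coset (g ** h) = coset g"
proof (intro set_eqI iffI)
  fix x assume "x \<in> coset (g ** h)"
  then show "x \<in> coset g"
    using assms Tmax_mult by (auto simp: coset_def matrix_mul_assoc[symmetric])
next
  fix x assume "x \<in> coset g"
  then obtain k where k: "k \<in> Tmax" "x = g ** k" by (auto simp: coset_def)
  then have "x = (g ** h) ** (adj h ** k)"
    using SU3_cancel[OF Tmax_SU3[OF assms]] by (simp add: matrix_mul_assoc[symmetric])
  then show "x \<in> coset (g ** h)"
    unfolding coset_def using k Tmax_mult Tmax_adj assms by blast
qed

lemma quot_mult_Tmax: "h \<in> Tmax \<Longrightarrow> quot (g ** h) = quot g"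
  by (simp add: quot_def coset_mult_Tmax)

lemma Rep_quot: "g \<in> SU3 \<Longrightarrow> Rep_flag (quot g) = coset g"
  by (simp add: quot_def Abs_flag_inverse)

lemma act_quot: "x \<in> SU3 \<Longrightarrow> act g (quot x) = quot (g ** x)"
  by (simp add: act_def Rep_quot) (simp add: quot_def coset_def image_image matrix_mul_assoc)

lemma act_origin: "act g origin = quot g"
  by (simp add: origin_def act_quot SU3_one)

lemma quot_surj: obtains g where "g \<in> SU3" "p = quot g"
proof -
  obtain g where "g \<in> SU3" "Rep_flag p = coset g"
    using Rep_flag[of p] by blast
  then show ?thesis
    using that Rep_flag_inverse[of p] by (simp add: quot_def)
qed

lemma quot_eqD:
  assumes "quot g = quot g'" "g \<in> SU3" "g' \<in> SU3"
  obtains h where "h \<in> Tmax" "g = g' ** h"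
proof -
  have "g ** mat 1 \<in> coset g"
    unfolding coset_def using Tmax_one by blast
  moreover have "coset g = coset g'"
    using assms Rep_quot by metis
  ultimately show ?thesis
    using that by (auto simp: coset_def)
qed

lemma frame: "frame p \<in> SU3" "quot (frame p) = p"
proof -
  have "\<exists>g. g \<in> SU3 \<and> act g origin = p"
    using quot_surj[of p] by (metis act_origin)
  from someI_ex[OF this] show "frame p \<in> SU3" "quot (frame p) = p"
    by (simp_all add: frame_def act_origin)
qed

section \<open>The space \<open>\<mm>\<close> and conjugation by the torus\<close>

lemma matD_entries [simp]:
  "matD a b c $ 1 $ 1 = 0" "matD a b c $ 1 $ 2 = a" "matD a b c $ 1 $ 3 = cnj c"
  "matD a b c $ 2 $ 1 = - cnj a" "matD a b c $ 2 $ 2 = 0" "matD a b c $ 2 $ 3 = b"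
  "matD a b c $ 3 $ 1 = - c" "matD a b c $ 3 $ 2 = - cnj b" "matD a b c $ 3 $ 3 = 0"
  by (simp_all add: matD_def)

lemma param_matD [simp]: "param_a (matD a b c) = a" "param_b (matD a b c) = b" "param_c (matD a b c) = c"
  by (simp_all add: param_a_def param_b_def param_c_def)

lemma matD_in_m [simp]: "matD a b c \<in> \<mm>"
  by (auto simp: \<mm>_def)

lemma m_cases: assumes "A \<in> \<mm>" obtains a b c where "A = matD a b c"
  using assms by (auto simp: \<mm>_def)

text \<open>These real-linear conditions survive linear combinations, torus conjugation and
  differentiation. They also force trace zero, as \<open>mexp_SU3\<close> requires.\<close>

lemma m_iff: "A \<in> \<mm> \<longleftrightarrow> adj A = - A \<and> (\<forall>i. A $ i $ i = 0)"
proof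
  show "A \<in> \<mm> \<Longrightarrow> adj A = - A \<and> (\<forall>i. A $ i $ i = 0)"
    by (auto simp: \<mm>_def vec_eq_iff forall_3 adj_def)
next
  assume A: "adj A = - A \<and> (\<forall>i. A $ i $ i = 0)"
  then have *: "cnj (A $ j $ i) = - (A $ i $ j)" for i j
    by (auto simp: adj_def vec_eq_iff)
  have "A $ 2 $ 1 = - cnj (A $ 1 $ 2)" "A $ 3 $ 2 = - cnj (A $ 2 $ 3)" "A $ 1 $ 3 = - cnj (A $ 3 $ 1)"
    using *[of 1 2] *[of 2 3] *[of 3 1] by simp_all
  then have "A = matD (A $ 1 $ 2) (A $ 2 $ 3) (- (A $ 3 $ 1))"
    using A by (simp add: vec_eq_iff forall_3)
  then show "A \<in> \<mm>" by (metis matD_in_m)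
qed

lemma m_SU3: "A \<in> \<mm> \<Longrightarrow> mexp (\<tau> *\<^sub>R A) \<in> SU3"
  by (rule mexp_SU3) (auto simp: m_iff trace_def)

lemma m_scaleR: "A \<in> \<mm> \<Longrightarrow> r *\<^sub>R A \<in> \<mm>"
  and m_add: "A \<in> \<mm> \<Longrightarrow> B \<in> \<mm> \<Longrightarrow> A + B \<in> \<mm>"
  and m_diff: "A \<in> \<mm> \<Longrightarrow> B \<in> \<mm> \<Longrightarrow> A - B \<in> \<mm>"
  and m_zero: "0 \<in> \<mm>"
  by (auto simp: m_iff adj_def vec_eq_iff)

lemma Tmax_entries:
  assumes "h \<in> Tmax"
  shows "i \<noteq> j \<Longrightarrow> h $ i $ j = 0" "h $ i $ i * cnj (h $ i $ i) = 1"
proof -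
  show *: "h $ i $ j = 0" if "i \<noteq> j" for i j
    using assms that by (simp add: Tmax_def)
  have "(h ** adj h) $ i $ i = 1"
    using assms by (simp add: Tmax_def SU3_def mat_def)
  moreover have "(h ** adj h) $ i $ i = (\<Sum>k\<in>UNIV. if k = i then h $ i $ i * cnj (h $ i $ i) else 0)"
    unfolding matrix_matrix_mult_def adj_def vec_lambda_beta
    by (rule sum.cong[OF refl]) (metis * mult_zero_left)
  ultimately show "h $ i $ i * cnj (h $ i $ i) = 1" by simp
qed

lemma Tmax_conj_entry:
  assumes "h \<in> Tmax"
  shows "(h ** A ** adj h) $ i $ j = h $ i $ i * A $ i $ j * cnj (h $ j $ j)"
proof -
  have "(h ** A) $ i $ k = h $ i $ i * A $ i $ k" for k
  proof -
    have "(h ** A) $ i $ k = (\<Sum>l\<in>UNIV. if l = i then h $ i $ i * A $ i $ k else 0)"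
      unfolding matrix_matrix_mult_def vec_lambda_beta
      by (rule sum.cong[OF refl]) (metis Tmax_entries(1)[OF assms] mult_zero_left)
    then show ?thesis by simp
  qed
  moreover have "(h ** A ** adj h) $ i $ j =
      (\<Sum>l\<in>UNIV. if l = j then (h ** A) $ i $ j * cnj (h $ j $ j) else 0)"
    unfolding matrix_matrix_mult_def[of "h ** A"] adj_def vec_lambda_beta
    by (rule sum.cong[OF refl]) (metis Tmax_entries(1)[OF assms] mult_zero_right complex_cnj_zero)
  ultimately show ?thesis by simp
qed

lemma Tmax_conj_m: "h \<in> Tmax \<Longrightarrow> A \<in> \<mm> \<Longrightarrow> h ** A ** adj h \<in> \<mm>"
  by (simp add: m_iff Tmax_conj_entry adj_mult matrix_mul_assoc matrix_minus_left matrix_minus_right)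

subsection \<open>Tangent vectors\<close>

lemma smoothG_left_translate:
  assumes "smoothG F" "g \<in> SU3"
  shows "smoothG (\<lambda>x. F (g ** x))"
  unfolding smoothG_def
proof
  fix x assume "x \<in> SU3"
  then obtain U E where U: "g ** x \<in> U" "smooth_on_open U E" "\<forall>y \<in> U \<inter> SU3. E y = F y"
    using assms SU3_mult unfolding smoothG_def by meson
  have L: "bounded_linear (\<lambda>x::cmat. g ** x)"
    by (rule bounded_bilinear.bounded_linear_right[OF bounded_bilinear_matrix_mult])
  have "open ((\<lambda>x. g ** x) -` U)"
    using U(2) linear_continuous_on[OF L, of UNIV]
    by (intro open_vimage) (auto simp: smooth_on_open_def)
  then have "smooth_on_open ((\<lambda>x. g ** x) -` U) (\<lambda>x. E (g ** x))"
    using U(2) Ck_on_compose_linear[OF L, of "(\<lambda>x. g ** x) -` U" U]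
    by (auto simp: smooth_on_open_def)
  then show "\<exists>U E. x \<in> U \<and> smooth_on_open U E \<and> (\<forall>y\<in>U \<inter> SU3. E y = F (g ** y))"
    using U assms(2) SU3_mult by (intro exI[of _ "(\<lambda>x. g ** x) -` U"] exI[of _ "\<lambda>x. E (g ** x)"]) auto
qed

lemma smooth_iff: "smooth \<phi> \<longleftrightarrow> smoothG (\<lambda>x. \<phi> (quot x))"
  by (simp add: smooth_def smoothG_real o_def)

text \<open>Makes \<open>push\<close> compatible with the convention that tangent vectors vanish on
  functions that are not smooth. The backward direction translates by \<open>adj g\<close>.\<close>

lemma smooth_act_iff:
  assumes "g \<in> SU3"
  shows "smooth (\<lambda>p. \<phi> (act g p)) \<longleftrightarrow> smooth \<phi>"
proof -
  have *: "smooth (\<lambda>p. \<phi> (act g p)) \<longleftrightarrow> smoothG (\<lambda>x. \<phi> (quot (g ** x)))" for \<phi> g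
    unfolding smooth_iff by (rule smoothG_cong) (simp add: act_quot)
  show ?thesis
  proof
    assume "smooth \<phi>"
    then show "smooth (\<lambda>p. \<phi> (act g p))"
      unfolding * using smoothG_left_translate[OF _ assms] by (auto simp: smooth_iff)
  next
    assume "smooth (\<lambda>p. \<phi> (act g p))"
    then have "smoothG (\<lambda>x. \<phi> (quot (g ** (adj g ** x))))"
      unfolding * using smoothG_left_translate[OF _ SU3_adj[OF assms]] by blast
    then show "smooth \<phi>"
      by (simp add: smooth_iff SU3_cancel[OF assms])
  qed
qed

text \<open>The left-invariant field of \<open>A\<close>, with value \<open>g ** A\<close> at
  \<open>g\<close>, applied to \<open>F\<close>. For \<open>A\<close> in \<open>\<mm>\<close> the
  curve stays in \<open>SU3\<close>.\<close>

definition lderiv :: "(cmat \<Rightarrow> 'b::real_normed_vector) \<Rightarrow> cmat \<Rightarrow> cmat \<Rightarrow> 'b" where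
  "lderiv F g A = vector_derivative (\<lambda>\<tau>. F (g ** mexp (\<tau> *\<^sub>R A))) (at 0)"

lemma left_curve_deriv: fixes g :: cmat shows "((\<lambda>\<tau>. g ** mexp (\<tau> *\<^sub>R A)) has_vector_derivative g ** A) (at 0)"
  using bounded_linear.has_vector_derivative[OF
      bounded_bilinear.bounded_linear_right[OF bounded_bilinear_matrix_mult] mexp_deriv[of A 0], of g]
  by simp

lemma lderiv_works:
  assumes "curve_derivative F g L" "g \<in> SU3" "A \<in> \<mm>"
  shows "((\<lambda>\<tau>. F (g ** mexp (\<tau> *\<^sub>R A))) has_vector_derivative L (g ** A)) (at 0)"
  by (rule curve_derivativeD[OF assms(1) _ _ left_curve_deriv])
    (use assms in \<open>simp_all add: SU3_mult m_SU3\<close>)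

lemma lderiv_eq:
  assumes "curve_derivative F g L" "g \<in> SU3" "A \<in> \<mm>"
  shows "lderiv F g A = L (g ** A)"
  unfolding lderiv_def by (rule vector_derivative_at[OF lderiv_works[OF assms]])

lemma has_lderiv:
  assumes "smoothG F" "g \<in> SU3" "A \<in> \<mm>"
  shows "((\<lambda>\<tau>. F (g ** mexp (\<tau> *\<^sub>R A))) has_vector_derivative lderiv F g A) (at 0)"
proof -
  obtain L where "curve_derivative F g L"
    using smoothG_curve_derivative[OF assms(1,2)] by blast
  then show ?thesis
    using lderiv_works[of F g L A] lderiv_eq[of F g L A] assms(2,3) by simp
qed

lemma lderiv_linear:
  assumes "smoothG F" "g \<in> SU3"
  shows "A \<in> \<mm> \<Longrightarrow> B \<in> \<mm> \<Longrightarrow> lderiv F g (A + B) = lderiv F g A + lderiv F g B"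
    and "A \<in> \<mm> \<Longrightarrow> lderiv F g (r *\<^sub>R A) = r *\<^sub>R lderiv F g A"
proof -
  obtain L where L: "curve_derivative F g L"
    using smoothG_curve_derivative[OF assms] by blast
  then have "linear L" by (simp add: curve_derivative_def)
  then show "A \<in> \<mm> \<Longrightarrow> B \<in> \<mm> \<Longrightarrow> lderiv F g (A + B) = lderiv F g A + lderiv F g B"
    and "A \<in> \<mm> \<Longrightarrow> lderiv F g (r *\<^sub>R A) = r *\<^sub>R lderiv F g A"
    using lderiv_eq[OF L assms(2)]
    by (simp_all add: m_add m_scaleR matrix_add_right matrix_scaleR_right linear_add linear_scale)
qed

text \<open>Here \<open>g\<close> may be any representative of the base point, not only the chosen
  \<open>frame\<close>.\<close>

definition tv :: "cmat \<Rightarrow> cmat \<Rightarrow> tangent" where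
  "tv g A = push g (at_origin A)"

lemma tv_apply:
  assumes "g \<in> SU3" "A \<in> \<mm>"
  shows "tv g A \<phi> = (if smooth \<phi> then lderiv (\<lambda>x. \<phi> (quot x)) g A else 0)"
proof (cases "smooth \<phi>")
  case True
  have "((\<lambda>\<tau>. \<phi> (quot (g ** mexp (\<tau> *\<^sub>R A)))) has_vector_derivative
      lderiv (\<lambda>x. \<phi> (quot x)) g A) (at 0)"
    using has_lderiv[of "\<lambda>x. \<phi> (quot x)"] True assms by (simp add: smooth_iff)
  then have "deriv (\<lambda>\<tau>. \<phi> (quot (g ** mexp (\<tau> *\<^sub>R A)))) 0 = lderiv (\<lambda>x. \<phi> (quot x)) g A"
    by (intro DERIV_imp_deriv) (simp add: has_real_derivative_iff_has_vector_derivative)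
  then show ?thesis
    using True assms
    by (simp add: tv_def push_def at_origin_def smooth_act_iff act_origin act_quot m_SU3)
next
  case False
  then show ?thesis
    using assms by (simp add: tv_def push_def at_origin_def smooth_act_iff)
qed

lemma tv_add:
  assumes "g \<in> SU3" "A \<in> \<mm>" "B \<in> \<mm>"
  shows "tv g (A + B) = tv g A + tv g B"
  using assms by (auto simp: fun_eq_iff tv_apply m_add lderiv_linear smooth_iff)

lemma tv_scale:
  assumes "g \<in> SU3" "A \<in> \<mm>"
  shows "tv g (r *\<^sub>R A) = scale r (tv g A)"
  using assms by (auto simp: fun_eq_iff tv_apply m_scaleR lderiv_linear smooth_iff scale_def)

lemma tv_zero: "g \<in> SU3 \<Longrightarrow> tv g 0 = 0"
  using tv_scale[of g 0 0] by (simp add: m_zero scale_def fun_eq_iff)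

lemma tv_diff:
  assumes "g \<in> SU3" "A \<in> \<mm>" "B \<in> \<mm>"
  shows "tv g (A - B) = tv g A - tv g B"
  using tv_add[of g "A - B" B] assms by (simp add: m_diff)

lemma tv_mult_Tmax:
  assumes "g \<in> SU3" "h \<in> Tmax" "A \<in> \<mm>"
  shows "tv (g ** h) A = tv g (h ** A ** adj h)"
proof
  fix \<phi> :: "flag \<Rightarrow> real"
  let ?F = "\<lambda>x. \<phi> (quot x)"
  have h: "h \<in> SU3" using assms(2) by (rule Tmax_SU3)
  have "lderiv ?F (g ** h) A = lderiv ?F g (h ** A ** adj h)" if "smooth \<phi>"
  proof -
    obtain L where L: "curve_derivative ?F g L"
      using smoothG_curve_derivative[OF \<open>smooth \<phi>\<close>[unfolded smooth_iff] assms(1)] by blast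
    \<comment> \<open>Right multiplication by \<open>adj h\<close> leaves the coset unchanged and
      moves the starting point back to \<open>g\<close>. \<open>curve_derivativeD\<close> accepts
      this curve although it is not written as \<open>g\<close> times an exponential.\<close>
    have "((\<lambda>\<tau>. ?F ((g ** h ** mexp (\<tau> *\<^sub>R A)) ** adj h)) has_vector_derivative
        L ((g ** h ** A) ** adj h)) (at 0)"
    proof (rule curve_derivativeD[OF L])
      show "((\<lambda>\<tau>. (g ** h ** mexp (\<tau> *\<^sub>R A)) ** adj h) has_vector_derivative (g ** h ** A) ** adj h) (at 0)"
        by (rule bounded_linear.has_vector_derivative[OF
              bounded_bilinear.bounded_linear_left[OF bounded_bilinear_matrix_mult] left_curve_deriv])
    qed (use assms h in \<open>auto intro!: SU3_mult SU3_adj m_SU3 simp: SU3_cancel\<close>)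
    then show ?thesis
      unfolding lderiv_def[of _ "g ** h"]
      using lderiv_eq[OF L assms(1) Tmax_conj_m[OF assms(2,3)]] quot_mult_Tmax[OF Tmax_adj[OF assms(2)]]
      by (simp add: vector_derivative_at matrix_mul_assoc)
  qed
  then show "tv (g ** h) A \<phi> = tv g (h ** A ** adj h) \<phi>"
    using assms h by (simp add: tv_apply SU3_mult Tmax_conj_m)
qed

subsection \<open>Test functions\<close>

definition comm :: "cmat \<Rightarrow> cmat \<Rightarrow> cmat" where
  "comm A B = A ** B - B ** A"

definition unit_diag :: "3 \<Rightarrow> cmat" where
  "unit_diag k = (\<chi> i j. if i = k \<and> j = k then 1 else 0)"

text \<open>For unitary \<open>g\<close>, the orthogonal projection onto the line spanned by column
  \<open>k\<close> of \<open>g\<close>.\<close>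

definition proj :: "3 \<Rightarrow> cmat \<Rightarrow> cmat" where
  "proj k g = g ** unit_diag k ** adj g"

text \<open>Column \<open>k\<close> of \<open>comm A (unit_diag k)\<close> is column
  \<open>k\<close> of \<open>A\<close> without its diagonal entry. This form shows that the
  commutators with all \<open>unit_diag k\<close> determine the off-diagonal part.\<close>

definition offdiag :: "cmat \<Rightarrow> cmat" where
  "offdiag A = (\<Sum>k\<in>UNIV. comm A (unit_diag k) ** unit_diag k)"

lemma offdiag_entry: "offdiag A $ i $ j = (if i = j then 0 else A $ i $ j)"
proof -
  have "\<forall>i j. offdiag A $ i $ j = (if i = j then 0 else A $ i $ j)"
    by (simp add: offdiag_def comm_def unit_diag_def matrix_matrix_mult_def sum_3 forall_3)
  then show ?thesis by blast
qed

lemma offdiag_m: "A \<in> \<mm> \<Longrightarrow> offdiag A = A"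
  by (auto simp: vec_eq_iff offdiag_entry m_iff)

lemma offdiag_eqI:
  "(\<And>k. comm A (unit_diag k) = comm B (unit_diag k)) \<Longrightarrow> offdiag A = offdiag B"
  by (simp add: offdiag_def)

lemma smoothG_mult:
  fixes F G :: "cmat \<Rightarrow> cmat"
  shows "smoothG F \<Longrightarrow> smoothG G \<Longrightarrow> smoothG (\<lambda>x. F x ** G x)"
  by (rule smoothG_bilinear[OF bounded_bilinear_matrix_mult])

lemma smoothG_adj: "smoothG F \<Longrightarrow> smoothG (\<lambda>x. adj (F x))"
  by (rule smoothG_linear[OF bounded_linear_adj])

lemma smoothG_proj: "smoothG (proj k)"
  unfolding proj_def by (intro smoothG_mult smoothG_adj smoothG_id smoothG_const)

text \<open>A diagonal unitary matrix fixes each \<open>unit_diag k\<close> under conjugation, so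
  the projections descend to the flag manifold.\<close>

lemma proj_mult_Tmax:
  assumes "h \<in> Tmax"
  shows "proj k (g ** h) = proj k g"
proof -
  have "h ** unit_diag k ** adj h = unit_diag k"
    by (simp add: vec_eq_iff Tmax_conj_entry[OF assms] Tmax_entries[OF assms] unit_diag_def)
  then show ?thesis
    by (simp add: proj_def adj_mult) (metis matrix_mul_assoc)
qed

definition test_fun :: "3 \<Rightarrow> cmat \<Rightarrow> flag \<Rightarrow> real" where
  "test_fun k b p = proj k (frame p) \<bullet> b"

lemma frame_quot:
  assumes "g \<in> SU3"
  obtains h where "h \<in> Tmax" "g = frame (quot g) ** h"
  using quot_eqD[of g "frame (quot g)"] assms frame by metis

lemma test_fun_quot: "g \<in> SU3 \<Longrightarrow> test_fun k b (quot g) = proj k g \<bullet> b"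
  by (metis test_fun_def frame_quot proj_mult_Tmax)

lemma smooth_test_fun: "smooth (test_fun k b)"
  unfolding smooth_iff
  using smoothG_cong[of "\<lambda>x. test_fun k b (quot x)" "\<lambda>x. proj k x \<bullet> b"] test_fun_quot
    smoothG_linear[OF bounded_linear_inner_left smoothG_proj] by simp

section \<open>Rules for derivatives along left-invariant directions\<close>

lemma lderiv_cong:
  assumes "\<And>x. x \<in> SU3 \<Longrightarrow> F x = G x" "g \<in> SU3" "A \<in> \<mm>"
  shows "lderiv F g A = lderiv G g A"
  using assms by (simp add: lderiv_def SU3_mult m_SU3)

lemma lderiv_compose_linear:
  assumes "bounded_linear L" "smoothG F" "g \<in> SU3" "A \<in> \<mm>"
  shows "lderiv (\<lambda>x. L (F x)) g A = L (lderiv F g A)"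
  unfolding lderiv_def[of "\<lambda>x. L (F x)"]
  by (intro vector_derivative_at bounded_linear.has_vector_derivative[OF assms(1)] has_lderiv assms)

lemma lderiv_bilinear:
  assumes "bounded_bilinear B" "smoothG F" "smoothG G" "g \<in> SU3" "A \<in> \<mm>"
  shows "lderiv (\<lambda>x. B (F x) (G x)) g A = B (F g) (lderiv G g A) + B (lderiv F g A) (G g)"
  unfolding lderiv_def[of "\<lambda>x. B (F x) (G x)"]
  using bounded_bilinear.has_vector_derivative[OF assms(1) has_lderiv has_lderiv,
      of F g A G g A] assms
  by (intro vector_derivative_at) simp

lemma lderiv_id: "lderiv (\<lambda>x. x) g A = g ** A"
  unfolding lderiv_def by (rule vector_derivative_at[OF left_curve_deriv])

lemma lderiv_const: "lderiv (\<lambda>x. c) g A = 0"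
  by (simp add: lderiv_def)

text \<open>The outer factors differentiate to \<open>g ** A\<close> and
  \<open>- A ** adj g\<close>; together these two terms form the commutator.\<close>

lemma lderiv_conj:
  assumes "smoothG F" "g \<in> SU3" "A \<in> \<mm>"
  shows "lderiv (\<lambda>x. x ** F x ** adj x) g A = g ** (comm A (F g) + lderiv F g A) ** adj g"
proof -
  have "adj A = - A" using assms(3) by (simp add: m_iff)
  then show ?thesis
    using assms
    by (simp add: lderiv_bilinear[OF bounded_bilinear_matrix_mult] smoothG_mult smoothG_adj smoothG_id
        lderiv_compose_linear[OF bounded_linear_adj] lderiv_id adj_mult comm_def
        matrix_add_left matrix_add_right matrix_diff_left matrix_diff_right
        matrix_minus_left matrix_minus_right matrix_mul_assoc)
qed

lemma lderiv_proj:
  assumes "g \<in> SU3" "A \<in> \<mm>"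
  shows "lderiv (proj k) g A = g ** comm A (unit_diag k) ** adj g"
  using lderiv_conj[OF smoothG_const assms] by (simp add: proj_def[abs_def] lderiv_const)

lemma tv_test_fun:
  assumes "g \<in> SU3" "A \<in> \<mm>"
  shows "tv g A (test_fun k b) = (g ** comm A (unit_diag k) ** adj g) \<bullet> b"
proof -
  have "lderiv (\<lambda>x. test_fun k b (quot x)) g A = lderiv (\<lambda>x. proj k x \<bullet> b) g A"
    by (rule lderiv_cong) (use assms test_fun_quot in auto)
  then show ?thesis
    using assms
    by (simp add: tv_apply smooth_test_fun lderiv_proj smoothG_proj
        lderiv_compose_linear[OF bounded_linear_inner_left])
qed

lemma conj_cancel:
  assumes "g \<in> SU3" "g ** A ** adj g = g ** B ** adj g"
  shows "A = B"
proof -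
  have "adj g ** (g ** A ** adj g) ** g = adj g ** (g ** B ** adj g) ** g"
    using assms(2) by simp
  then show ?thesis
    using SU3_cancel[OF assms(1)] assms(1) by (simp add: matrix_mul_assoc[symmetric] SU3_iff)
qed

text \<open>Test functions separate tangent vectors: the inner products determine the conjugated
  commutators, \<open>g\<close> cancels, and the commutators determine
  \<open>offdiag\<close>.\<close>

lemma tv_test_eqD:
  assumes "g \<in> SU3" "\<And>k b. (g ** comm A (unit_diag k) ** adj g) \<bullet> b = (g ** comm B (unit_diag k) ** adj g) \<bullet> b"
  shows "offdiag A = offdiag B"
proof (rule offdiag_eqI, rule conj_cancel[OF assms(1)])
  show "g ** comm A (unit_diag k) ** adj g = g ** comm B (unit_diag k) ** adj g" for k
    using assms(2)[of k] vector_eq_rdot by blast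
qed

lemma tv_inj:
  assumes "g \<in> SU3" "A \<in> \<mm>" "B \<in> \<mm>" "tv g A = tv g B"
  shows "A = B"
  using tv_test_eqD[of g A B] tv_test_fun[OF assms(1,2)] tv_test_fun[OF assms(1,3)] assms(4)
  by (simp add: offdiag_m assms)

section \<open>Tangent spaces and coordinates relative to an arbitrary representative\<close>

lemma tangent_space_quot:
  assumes "g \<in> SU3"
  shows "tangent_space (quot g) = tv g ` \<mm>"
proof (intro set_eqI iffI)
  fix v assume "v \<in> tangent_space (quot g)"
  then obtain g' A where g': "v = tv g' A" "g' \<in> SU3" "quot g' = quot g" "A \<in> \<mm>"
    by (auto simp: tangent_space_def act_origin tv_def)
  then obtain h where "h \<in> Tmax" "g' = g ** h"
    using quot_eqD assms by metis
  then show "v \<in> tv g ` \<mm>"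
    using g' tv_mult_Tmax[OF assms] Tmax_conj_m by auto
next
  fix v assume "v \<in> tv g ` \<mm>"
  then show "v \<in> tangent_space (quot g)"
    using assms by (auto simp: tangent_space_def act_origin tv_def)
qed

definition coordG :: "cmat \<Rightarrow> tangent \<Rightarrow> cmat" where
  "coordG g v = (THE A. A \<in> \<mm> \<and> v = tv g A)"

lemma coordG_tv: "g \<in> SU3 \<Longrightarrow> A \<in> \<mm> \<Longrightarrow> coordG g (tv g A) = A"
  unfolding coordG_def using tv_inj by (intro the_equality) auto

text \<open>\<open>coord\<close> refers to the chosen \<open>frame\<close>. Another representative
  changes it by a torus conjugation, to which invariant tensors are insensitive.\<close>

lemma coord_tv:
  assumes "g \<in> SU3"
  obtains h where "h \<in> Tmax" "g = frame (quot g) ** h"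
    "\<And>A. A \<in> \<mm> \<Longrightarrow> coord (quot g) (tv g A) = h ** A ** adj h"
proof -
  obtain h where h: "h \<in> Tmax" "g = frame (quot g) ** h"
    using frame_quot assms by blast
  have "coord (quot g) (tv g A) = h ** A ** adj h" if "A \<in> \<mm>" for A
  proof -
    have "tv g A = tv (frame (quot g)) (h ** A ** adj h)"
      using tv_mult_Tmax[OF frame(1)[of "quot g"] h(1) that] h(2) by simp
    then show ?thesis
      using coordG_tv[OF frame(1)] Tmax_conj_m[OF h(1) that]
      by (simp add: coord_def coordG_def tv_def)
  qed
  with h that show ?thesis by blast
qed

subsection \<open>Invariant tensors\<close>

lemma metric_origin_eq:
  "metric_origin l1 l2 l3 A B = l1 * Re (param_a A * cnj (param_a B)) +
     l2 * Re (param_b A * cnj (param_b B)) + l3 * Re (param_c A * cnj (param_c B))"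
  by (simp add: metric_origin_def ip_origin_def trace_def sum_3 matrix_matrix_mult_def algebra_simps)

text \<open>The torus acts on each summand of \<open>\<mm>\<close> by a complex number, of modulus
  one by \<open>Tmax_entries\<close>. Hermitian products are therefore preserved, and multiplication
  by \<open>\<i>\<close> commutes with the action.\<close>

lemma param_Tmax_conj:
  assumes "h \<in> Tmax"
  shows "param_a (h ** A ** adj h) = (h $ 1 $ 1 * cnj (h $ 2 $ 2)) * param_a A"
    "param_b (h ** A ** adj h) = (h $ 2 $ 2 * cnj (h $ 3 $ 3)) * param_b A"
    "param_c (h ** A ** adj h) = (h $ 3 $ 3 * cnj (h $ 1 $ 1)) * param_c A"
  by (simp_all add: param_a_def param_b_def param_c_def Tmax_conj_entry[OF assms])

lemma metric_origin_Tmax_conj: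
  assumes "h \<in> Tmax"
  shows "metric_origin l1 l2 l3 (h ** A ** adj h) (h ** B ** adj h) = metric_origin l1 l2 l3 A B"
proof -
  have *: "(u * cnj v * x) * cnj (u * cnj v * y) = (u * cnj u) * (v * cnj v) * (x * cnj y)" for u v x y :: complex
    by (simp add: algebra_simps)
  then show ?thesis
    unfolding metric_origin_eq param_Tmax_conj[OF assms] 
    by (simp only: * Tmax_entries[OF assms] mult_1_left)
qed

lemma f_origin_m [simp]: "f_origin z1 z2 z3 A \<in> \<mm>"
  by (simp add: f_origin_def)

lemma param_f_origin [simp]:
  "param_a (f_origin z1 z2 z3 A) = of_real z1 * \<i> * param_a A"
  "param_b (f_origin z1 z2 z3 A) = of_real z2 * \<i> * param_b A"
  "param_c (f_origin z1 z2 z3 A) = of_real z3 * \<i> * param_c A"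
  by (simp_all add: f_origin_def)

lemma m_eqI:
  assumes "A \<in> \<mm>" "B \<in> \<mm>" "param_a A = param_a B" "param_b A = param_b B" "param_c A = param_c B"
  shows "A = B"
  using assms by (auto elim!: m_cases)

lemma f_origin_Tmax_conj:
  assumes "h \<in> Tmax"
  shows "f_origin z1 z2 z3 (h ** A ** adj h) = h ** f_origin z1 z2 z3 A ** adj h"
  by (rule m_eqI) (simp_all add: Tmax_conj_m assms param_Tmax_conj)

lemma linear_f_origin: "linear (f_origin z1 z2 z3)"
proof (rule linearI)
  show "f_origin z1 z2 z3 (A + B) = f_origin z1 z2 z3 A + f_origin z1 z2 z3 B" for A B
    by (simp add: f_origin_def vec_eq_iff forall_3 param_a_def param_b_def param_c_def algebra_simps)
  show "f_origin z1 z2 z3 (r *\<^sub>R A) = r *\<^sub>R f_origin z1 z2 z3 A" for r A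
    by (simp add: f_origin_def vec_eq_iff forall_3 param_a_def param_b_def param_c_def scaleR_conv_of_real[where 'a = complex] algebra_simps)
qed

text \<open>The metric has the same constant coefficients at every \<open>g\<close>, so derivatives
  of \<open>g(Y, Z)\<close> fall only on the lifts.\<close>

lemma inv_metric_tv:
  assumes "g \<in> SU3" "A \<in> \<mm>" "B \<in> \<mm>"
  shows "inv_metric l1 l2 l3 (quot g) (tv g A) (tv g B) = metric_origin l1 l2 l3 A B"
proof -
  obtain h where "h \<in> Tmax" "\<And>A. A \<in> \<mm> \<Longrightarrow> coord (quot g) (tv g A) = h ** A ** adj h"
    using coord_tv assms(1) by blast
  then show ?thesis
    using assms by (simp add: inv_metric_def metric_origin_Tmax_conj)
qed

lemma inv_f_tv:
  assumes "g \<in> SU3" "A \<in> \<mm>"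
  shows "inv_f z1 z2 z3 (quot g) (tv g A) = tv g (f_origin z1 z2 z3 A)"
proof -
  obtain h where h: "h \<in> Tmax" "g = frame (quot g) ** h"
    "\<And>A. A \<in> \<mm> \<Longrightarrow> coord (quot g) (tv g A) = h ** A ** adj h"
    using coord_tv assms(1) by blast
  then have "inv_f z1 z2 z3 (quot g) (tv g A) = tv (frame (quot g)) (h ** f_origin z1 z2 z3 A ** adj h)"
    using assms by (simp add: inv_f_def f_origin_Tmax_conj tv_def)
  also have "\<dots> = tv g (f_origin z1 z2 z3 A)"
    using tv_mult_Tmax[OF frame(1)[of "quot g"] h(1), of "f_origin z1 z2 z3 A"] h(2) by simp
  finally show ?thesis .
qed

subsection \<open>Lifting vector fields\<close>

definition lift :: "vfield \<Rightarrow> cmat \<Rightarrow> cmat" where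
  "lift X g = coordG g (X (quot g))"

lemma lift_eqI: "g \<in> SU3 \<Longrightarrow> A \<in> \<mm> \<Longrightarrow> X (quot g) = tv g A \<Longrightarrow> lift X g = A"
  by (simp add: lift_def coordG_tv)

lemma vector_field_lift:
  assumes "X \<in> vector_fields" "g \<in> SU3"
  shows "lift X g \<in> \<mm>" "X (quot g) = tv g (lift X g)"
proof -
  have "X (quot g) \<in> tangent_space (quot g)"
    using assms(1) by (simp add: vector_fields_def)
  then obtain A where "A \<in> \<mm>" "X (quot g) = tv g A"
    unfolding tangent_space_quot[OF assms(2)] by blast
  then show "lift X g \<in> \<mm>" "X (quot g) = tv g (lift X g)"
    using lift_eqI[OF assms(2)] by auto
qed

text \<open>By definition a vector field maps each test function to a smooth function; the lift is
  recovered from these images by smooth operations.\<close>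

lemma smoothG_lift:
  assumes "X \<in> vector_fields"
  shows "smoothG (lift X)"
proof -
  have *: "smoothG (\<lambda>g. g ** comm (lift X g) (unit_diag k) ** adj g)" for k
  proof (rule smoothG_euclidean)
    fix b
    have "smoothG (\<lambda>g. X (quot g) (test_fun k b))"
      using assms smooth_test_fun by (auto simp: vector_fields_def smooth_iff deriv_along_def)
    then show "smoothG (\<lambda>g. (g ** comm (lift X g) (unit_diag k) ** adj g) \<bullet> b)"
      by (subst (asm) smoothG_cong) (auto simp: vector_field_lift[OF assms] tv_test_fun)
  qed
  \<comment> \<open>Undoing the conjugation by \<open>g\<close> turns this sum into the one defining
    \<open>offdiag (lift X g)\<close>.\<close>
  have "smoothG (\<lambda>g. \<Sum>k\<in>UNIV. adj g ** (g ** comm (lift X g) (unit_diag k) ** adj g) ** g ** unit_diag k)"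
    by (intro smoothG_sum finite
        smoothG_mult[OF smoothG_mult[OF smoothG_mult[OF smoothG_adj[OF smoothG_id] *] smoothG_id] smoothG_const])
  moreover have "adj g ** (g ** C ** adj g) ** g ** D = C ** D" if "g \<in> SU3" for g C and D :: cmat
    using SU3_cancel[OF that] by (simp add: matrix_mul_assoc[symmetric])
  ultimately have "smoothG (\<lambda>g. offdiag (lift X g))"
    unfolding offdiag_def by (subst (asm) smoothG_cong) auto
  then show ?thesis
    by (subst (asm) smoothG_cong) (auto simp: offdiag_m vector_field_lift[OF assms])
qed

lemma smoothG_lderiv:
  fixes F :: "cmat \<Rightarrow> 'b::real_normed_vector"
  assumes "smoothG F" "smoothG x" "\<And>g. g \<in> SU3 \<Longrightarrow> x g \<in> \<mm>"
  shows "smoothG (\<lambda>g. lderiv F g (x g))"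
  unfolding smoothG_def
proof
  fix g assume g: "g \<in> SU3"
  obtain U E where U: "g \<in> U" "smooth_on_open U E" "\<forall>x \<in> U \<inter> SU3. E x = F x"
    using assms(1) g unfolding smoothG_def by blast
  obtain V H where V: "g \<in> V" "smooth_on_open V H" "\<forall>y \<in> V \<inter> SU3. H y = x y"
    using assms(2) g unfolding smoothG_def by blast
  let ?W = "U \<inter> V"
  \<comment> \<open>\<open>smooth_on_open_derivative\<close> treats fixed directions, so the varying
    direction \<open>y ** H y\<close> is expanded in a basis.\<close>
  let ?K = "\<lambda>y. \<Sum>b\<in>Basis. ((y ** H y) \<bullet> b) *\<^sub>R frechet_derivative E (at y) b"
  have W: "open ?W" using U V by (auto simp: smooth_on_open_def)
  have "smooth_on_open ?W (\<lambda>y. y ** H y)"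
    by (intro smooth_on_open_bilinear[OF bounded_bilinear_matrix_mult] smooth_on_open_id W)
      (use V W in \<open>auto elim: smooth_on_open_subset\<close>)
  then have "smooth_on_open ?W ?K"
    by (intro smooth_on_open_sum W finite_Basis smooth_on_open_bilinear[OF bounded_bilinear_scaleR]
        smooth_on_open_linear[OF bounded_linear_inner_left] smooth_on_open_derivative)
      (use U W in \<open>auto elim: smooth_on_open_subset\<close>)
  moreover have "?K y = lderiv F y (x y)" if y: "y \<in> ?W \<inter> SU3" for y
  proof -
    have c: "curve_derivative F y (frechet_derivative E (at y))"
      using U y by (intro curve_derivative_extension) auto
    then have L: "linear (frechet_derivative E (at y))"
      by (simp add: curve_derivative_def)
    have "lderiv F y (x y) = frechet_derivative E (at y) (y ** H y)"
      using lderiv_eq[OF c] y assms(3) V(3) by auto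
    also have "\<dots> = frechet_derivative E (at y) (\<Sum>b\<in>Basis. ((y ** H y) \<bullet> b) *\<^sub>R b)"
      by (simp add: euclidean_representation)
    also have "\<dots> = ?K y"
      by (simp add: linear_sum[OF L] linear_scale[OF L])
    finally show ?thesis by simp
  qed
  ultimately show "\<exists>U E. g \<in> U \<and> smooth_on_open U E \<and> (\<forall>y\<in>U \<inter> SU3. E y = lderiv F y (x y))"
    using U V by (intro exI[of _ ?W] exI[of _ ?K]) auto
qed

text \<open>The converse of lifting. The last assumption ranges over all representatives and so
  contains the compatibility of \<open>x\<close> with the torus.\<close>

lemma vector_fieldI:
  assumes "smoothG x" "\<And>g. g \<in> SU3 \<Longrightarrow> x g \<in> \<mm>" "\<And>g. g \<in> SU3 \<Longrightarrow> X (quot g) = tv g (x g)"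
  shows "X \<in> vector_fields"
  unfolding vector_fields_def
proof (intro CollectI conjI allI impI)
  fix p show "X p \<in> tangent_space p"
    using assms tangent_space_quot quot_surj[of p] by (metis image_eqI)
next
  fix \<phi> assume s: "smooth \<phi>"
  have "smoothG (\<lambda>g. lderiv (\<lambda>x. \<phi> (quot x)) g (x g))"
    using s assms by (intro smoothG_lderiv) (auto simp: smooth_iff)
  then show "smooth (deriv_along X \<phi>)"
    unfolding smooth_iff deriv_along_def
    by (subst smoothG_cong) (auto simp: assms tv_apply s)
qed

section \<open>Lifts of sums, multiples and images under \<open>f\<close>\<close>

lemma vector_fields_add:
  assumes "X \<in> vector_fields" "Y \<in> vector_fields"
  shows "X + Y \<in> vector_fields" "g \<in> SU3 \<Longrightarrow> lift (X + Y) g = lift X g + lift Y g"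
proof -
  have *: "(X + Y) (quot g) = tv g (lift X g + lift Y g)" if "g \<in> SU3" for g
    using that vector_field_lift assms by (simp add: tv_add)
  show "X + Y \<in> vector_fields"
    by (rule vector_fieldI[OF _ _ *]) (use assms vector_field_lift in \<open>auto intro!: smoothG_add smoothG_lift m_add\<close>)
  show "g \<in> SU3 \<Longrightarrow> lift (X + Y) g = lift X g + lift Y g"
    using * assms vector_field_lift by (intro lift_eqI m_add) auto
qed

lemma smoothG_diff: "smoothG F \<Longrightarrow> smoothG G \<Longrightarrow> smoothG (\<lambda>x. F x - G x)"
  using smoothG_add[of F "\<lambda>x. - G x"] smoothG_linear[OF bounded_linear_minus[OF bounded_linear_ident], of G]
  by simp

lemma vector_fields_diff:
  assumes "X \<in> vector_fields" "Y \<in> vector_fields"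
  shows "X - Y \<in> vector_fields" "g \<in> SU3 \<Longrightarrow> lift (X - Y) g = lift X g - lift Y g"
proof -
  have *: "(X - Y) (quot g) = tv g (lift X g - lift Y g)" if "g \<in> SU3" for g
    using that vector_field_lift assms by (simp add: tv_diff)
  show "X - Y \<in> vector_fields"
    by (rule vector_fieldI[OF _ _ *]) (use assms vector_field_lift in \<open>auto intro!: smoothG_diff smoothG_lift m_diff\<close>)
  show "g \<in> SU3 \<Longrightarrow> lift (X - Y) g = lift X g - lift Y g"
    using * assms vector_field_lift by (intro lift_eqI m_diff) auto
qed

lemma vector_fields_smul_const:
  assumes "X \<in> vector_fields"
  shows "smul (\<lambda>_. r) X \<in> vector_fields" "g \<in> SU3 \<Longrightarrow> lift (smul (\<lambda>_. r) X) g = r *\<^sub>R lift X g"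
proof -
  have *: "smul (\<lambda>_. r) X (quot g) = tv g (r *\<^sub>R lift X g)" if "g \<in> SU3" for g
    using that vector_field_lift assms by (simp add: tv_scale smul_def)
  show "smul (\<lambda>_. r) X \<in> vector_fields"
    by (rule vector_fieldI[OF _ _ *])
      (use assms vector_field_lift in \<open>auto intro!: smoothG_linear[OF bounded_linear_scaleR_right] smoothG_lift m_scaleR\<close>)
  show "g \<in> SU3 \<Longrightarrow> lift (smul (\<lambda>_. r) X) g = r *\<^sub>R lift X g"
    using * assms vector_field_lift by (intro lift_eqI m_scaleR) auto
qed

lemma bounded_linear_f_origin: "bounded_linear (f_origin z1 z2 z3)"
  using linear_f_origin linear_conv_bounded_linear by blast

lemma vector_fields_app:
  assumes "X \<in> vector_fields"
  shows "app (inv_f z1 z2 z3) X \<in> vector_fields"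
    "g \<in> SU3 \<Longrightarrow> lift (app (inv_f z1 z2 z3) X) g = f_origin z1 z2 z3 (lift X g)"
proof -
  have *: "app (inv_f z1 z2 z3) X (quot g) = tv g (f_origin z1 z2 z3 (lift X g))" if "g \<in> SU3" for g
    using that vector_field_lift assms by (simp add: app_def inv_f_tv)
  show "app (inv_f z1 z2 z3) X \<in> vector_fields"
    by (rule vector_fieldI[OF _ _ *])
      (use assms in \<open>auto intro!: smoothG_linear[OF bounded_linear_f_origin] smoothG_lift\<close>)
  show "g \<in> SU3 \<Longrightarrow> lift (app (inv_f z1 z2 z3) X) g = f_origin z1 z2 z3 (lift X g)"
    using * by (intro lift_eqI) auto
qed

lemma vector_field_zeroI:
  assumes "X \<in> vector_fields" "\<And>g. g \<in> SU3 \<Longrightarrow> lift X g = 0"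
  shows "X = 0"
proof
  fix p
  obtain g where "g \<in> SU3" "p = quot g" by (rule quot_surj)
  then show "X p = 0 p"
    using vector_field_lift[OF assms(1)] assms(2) tv_zero by simp
qed

subsection \<open>Lifts of brackets and connections\<close>

text \<open>The linear equations for \<open>\<mm>\<close> in \<open>m_iff\<close> hold along the
  whole lift, hence also for its derivative.\<close>

lemma lderiv_lift_m:
  assumes "X \<in> vector_fields" "g \<in> SU3" "A \<in> \<mm>"
  shows "lderiv (lift X) g A \<in> \<mm>"
proof -
  note s = smoothG_lift[OF assms(1)]
  have "adj (lderiv (lift X) g A) = lderiv (\<lambda>h. adj (lift X h)) g A"
    by (rule lderiv_compose_linear[OF bounded_linear_adj s assms(2,3), symmetric])
  also have "\<dots> = lderiv (\<lambda>h. - lift X h) g A"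
    by (rule lderiv_cong[OF _ assms(2,3)]) (use vector_field_lift(1)[OF assms(1)] m_iff in auto)
  also have "\<dots> = - lderiv (lift X) g A"
    by (rule lderiv_compose_linear[OF bounded_linear_minus[OF bounded_linear_ident] s assms(2,3)])
  finally have 1: "adj (lderiv (lift X) g A) = - lderiv (lift X) g A" .
  have "lderiv (lift X) g A $ i $ i = 0" for i
  proof -
    have L: "bounded_linear (\<lambda>M::cmat. M $ i $ i)"
      using bounded_linear_compose[OF bounded_linear_vec_nth bounded_linear_vec_nth] .
    have "lderiv (lift X) g A $ i $ i = lderiv (\<lambda>h. lift X h $ i $ i) g A"
      by (rule lderiv_compose_linear[OF L s assms(2,3), symmetric])
    also have "\<dots> = lderiv (\<lambda>h. 0) g A"
      by (rule lderiv_cong[OF _ assms(2,3)]) (use vector_field_lift(1)[OF assms(1)] m_iff in auto)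
    finally show ?thesis by (simp add: lderiv_const)
  qed
  with 1 show ?thesis by (simp add: m_iff)
qed

lemma bounded_linear_comm_left: "bounded_linear (\<lambda>A. comm A B)"
  unfolding comm_def
  by (intro bounded_linear_sub bounded_bilinear.bounded_linear_left[OF bounded_bilinear_matrix_mult]
      bounded_bilinear.bounded_linear_right[OF bounded_bilinear_matrix_mult])

text \<open>The Jacobi identity, in the shape in which iterated derivatives of test functions
  produce it.\<close>

lemma jacobi: "comm A (comm B C) - comm B (comm A C) = comm (comm A B) C"
  by (simp add: comm_def matrix_diff_left matrix_diff_right matrix_mul_assoc)

text \<open>\<open>Y\<close> maps the test function to a coordinate of
  \<open>h ** comm (lift Y h) (unit_diag k) ** adj h\<close>, so \<open>lderiv_conj\<close> applies
  a second time.\<close>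

lemma lderiv_test_fun:
  assumes "X \<in> vector_fields" "Y \<in> vector_fields" "g \<in> SU3"
  shows "X (quot g) (deriv_along Y (test_fun k b)) =
    (g ** (comm (lift X g) (comm (lift Y g) (unit_diag k)) +
      comm (lderiv (lift Y) g (lift X g)) (unit_diag k)) ** adj g) \<bullet> b"
proof -
  note X = vector_field_lift[OF assms(1)] and Y = vector_field_lift[OF assms(2)]
  let ?F = "\<lambda>h. comm (lift Y h) (unit_diag k)"
  have F: "smoothG ?F"
    by (rule smoothG_linear[OF bounded_linear_comm_left smoothG_lift[OF assms(2)]])
  have "smooth (deriv_along Y (test_fun k b))"
    using assms(2) smooth_test_fun by (auto simp: vector_fields_def)
  then have "X (quot g) (deriv_along Y (test_fun k b)) =
      lderiv (\<lambda>h. deriv_along Y (test_fun k b) (quot h)) g (lift X g)"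
    using X(2)[OF assms(3)] tv_apply[OF assms(3) X(1)[OF assms(3)]] by simp
  also have "\<dots> = lderiv (\<lambda>h. (h ** ?F h ** adj h) \<bullet> b) g (lift X g)"
    by (rule lderiv_cong[OF _ assms(3) X(1)[OF assms(3)]])
      (simp add: deriv_along_def Y(2) tv_test_fun Y(1))
  also have "\<dots> = lderiv (\<lambda>h. h ** ?F h ** adj h) g (lift X g) \<bullet> b"
    by (intro lderiv_compose_linear[OF bounded_linear_inner_left] smoothG_mult smoothG_id smoothG_adj F
        assms(3) X(1))
  also have "lderiv (\<lambda>h. h ** ?F h ** adj h) g (lift X g) =
      g ** (comm (lift X g) (?F g) + lderiv ?F g (lift X g)) ** adj g"
    by (rule lderiv_conj[OF F assms(3) X(1)[OF assms(3)]])
  also have "lderiv ?F g (lift X g) = comm (lderiv (lift Y) g (lift X g)) (unit_diag k)"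
    by (rule lderiv_compose_linear[OF bounded_linear_comm_left smoothG_lift[OF assms(2)] assms(3) X(1)[OF assms(3)]])
  finally show ?thesis .
qed

lemma linear_offdiag: "linear offdiag"
  by (rule linearI) (simp_all add: vec_eq_iff offdiag_entry)

definition comm_m :: "cmat \<Rightarrow> cmat \<Rightarrow> cmat" where
  "comm_m A B = offdiag (comm A B)"

text \<open>Both sides are compared on test functions. That \<open>W\<close> is a vector field is
  assumed; in the application \<open>W\<close> is a difference of two covariant derivatives.\<close>

lemma lift_bracket:
  assumes "X \<in> vector_fields" "Y \<in> vector_fields" "W \<in> vector_fields" "W = bracket X Y" "g \<in> SU3"
  shows "lift W g = lderiv (lift Y) g (lift X g) - lderiv (lift X) g (lift Y g) + comm_m (lift X g) (lift Y g)"
proof -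
  note m = vector_field_lift(1)[OF _ assms(5)]
  let ?x = "lift X g" and ?y = "lift Y g"
  let ?B = "lderiv (lift Y) g ?x - lderiv (lift X) g ?y + comm ?x ?y"
  have "offdiag (lift W g) = offdiag ?B"
  proof (rule tv_test_eqD[OF assms(5)])
    fix k b
    have "(g ** comm (lift W g) (unit_diag k) ** adj g) \<bullet> b = W (quot g) (test_fun k b)"
      using vector_field_lift[OF assms(3,5)] by (simp add: tv_test_fun assms(5))
    also have "\<dots> = X (quot g) (deriv_along Y (test_fun k b)) - Y (quot g) (deriv_along X (test_fun k b))"
      by (simp add: assms(4) bracket_def)
    also have "\<dots> = (g ** (comm ?x (comm ?y (unit_diag k)) - comm ?y (comm ?x (unit_diag k)) +
        (comm (lderiv (lift Y) g ?x) (unit_diag k) - comm (lderiv (lift X) g ?y) (unit_diag k))) ** adj g) \<bullet> b"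
      unfolding lderiv_test_fun[OF assms(1,2,5)] lderiv_test_fun[OF assms(2,1,5)]
      by (simp add: matrix_add_left matrix_add_right matrix_diff_left matrix_diff_right inner_diff_left inner_add_left)
    also have "\<dots> = (g ** comm ?B (unit_diag k) ** adj g) \<bullet> b"
      unfolding jacobi
      by (simp add: comm_def matrix_add_left matrix_add_right matrix_diff_left matrix_diff_right algebra_simps)
    finally show "(g ** comm (lift W g) (unit_diag k) ** adj g) \<bullet> b = (g ** comm ?B (unit_diag k) ** adj g) \<bullet> b" .
  qed
  \<comment> \<open>The derivative terms already lie in \<open>\<mm>\<close>, so
    \<open>offdiag\<close> acts only on the commutator.\<close>
  then show ?thesis
    using m assms(1-3) lderiv_lift_m[OF assms(1,5)] lderiv_lift_m[OF assms(2,5)]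
    by (simp add: linear_add[OF linear_offdiag] linear_diff[OF linear_offdiag] comm_m_def offdiag_m)
qed

section \<open>The metric on \<open>\<mm>\<close> and the Koszul formula\<close>

lemma bounded_bilinear_metric_origin: "bounded_bilinear (metric_origin l1 l2 l3)"
  unfolding bilinear_conv_bounded_bilinear[symmetric] bilinear_def
  by (auto intro!: linearI simp: metric_origin_eq param_a_def param_b_def param_c_def algebra_simps)

lemma metric_origin_sym: "metric_origin l1 l2 l3 A B = metric_origin l1 l2 l3 B A"
  by (simp add: metric_origin_eq algebra_simps)

lemma metric_origin_f_skew:
  "metric_origin l1 l2 l3 (f_origin z1 z2 z3 A) B = - metric_origin l1 l2 l3 A (f_origin z1 z2 z3 B)"
  by (simp add: metric_origin_eq algebra_simps)

lemma metric_origin_definite: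
  assumes "l1 > 0" "l2 > 0" "l3 > 0" "A \<in> \<mm>" "metric_origin l1 l2 l3 A A = 0"
  shows "A = 0"
proof -
  have "l1 * (cmod (param_a A))\<^sup>2 + l2 * (cmod (param_b A))\<^sup>2 + l3 * (cmod (param_c A))\<^sup>2 = 0"
    using assms(5) unfolding cmod_power2 by (simp add: metric_origin_eq power2_eq_square)
  moreover have "l1 * (cmod (param_a A))\<^sup>2 \<ge> 0" "l2 * (cmod (param_b A))\<^sup>2 \<ge> 0" "l3 * (cmod (param_c A))\<^sup>2 \<ge> 0"
    using assms by simp_all
  ultimately have "l1 * (cmod (param_a A))\<^sup>2 = 0" "l2 * (cmod (param_b A))\<^sup>2 = 0" "l3 * (cmod (param_c A))\<^sup>2 = 0"
    by linarith+
  then show ?thesis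
    using assms by (auto elim!: m_cases simp: vec_eq_iff forall_3)
qed

text \<open>The right-hand side of the Koszul formula with only its bracket terms, as for a metric
  with constant coefficients.\<close>

definition koszul_form :: "real \<Rightarrow> real \<Rightarrow> real \<Rightarrow> cmat \<Rightarrow> cmat \<Rightarrow> cmat \<Rightarrow> real" where
  "koszul_form l1 l2 l3 A B C = metric_origin l1 l2 l3 (comm_m A B) C -
    metric_origin l1 l2 l3 (comm_m B C) A + metric_origin l1 l2 l3 (comm_m C A) B"

text \<open>The Koszul formula makes this algebraic in the values of the lifts at \<open>g\<close>.\<close>

definition conn_tensor :: "connection \<Rightarrow> cmat \<Rightarrow> vfield \<Rightarrow> vfield \<Rightarrow> cmat" where
  "conn_tensor \<D> g X Y = lift (\<D> X Y) g - lderiv (lift Y) g (lift X g)"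

context
  fixes l1 l2 l3 :: real and \<D> :: connection
  assumes lc: "levi_civita (inv_metric l1 l2 l3) \<D>"
begin

lemma conn_vector_field: "X \<in> vector_fields \<Longrightarrow> Y \<in> vector_fields \<Longrightarrow> \<D> X Y \<in> vector_fields"
  using lc by (simp add: levi_civita_def affine_connection_def)

text \<open>The derivative terms in \<open>lift_bracket\<close> are exactly those subtracted in
  \<open>conn_tensor\<close>.\<close>

lemma conn_tensor_torsion:
  assumes "X \<in> vector_fields" "Y \<in> vector_fields" "g \<in> SU3"
  shows "conn_tensor \<D> g X Y - conn_tensor \<D> g Y X = comm_m (lift X g) (lift Y g)"
proof -
  note v = conn_vector_field[OF assms(1,2)] conn_vector_field[OF assms(2,1)]
  have "\<D> X Y - \<D> Y X = bracket X Y"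
    using lc assms by (simp add: levi_civita_def)
  from lift_bracket[OF assms(1,2) vector_fields_diff(1)[OF v] this assms(3)]
  show ?thesis
    by (simp add: conn_tensor_def vector_fields_diff(2)[OF v assms(3)] algebra_simps)
qed

text \<open>The product rule for the constant-coefficient metric yields the derivative terms of
  metric compatibility; what remains is skewness of the tensor.\<close>

lemma conn_tensor_metric:
  assumes "X \<in> vector_fields" "Y \<in> vector_fields" "Z \<in> vector_fields" "g \<in> SU3"
  shows "metric_origin l1 l2 l3 (conn_tensor \<D> g X Y) (lift Z g) +
    metric_origin l1 l2 l3 (lift Y g) (conn_tensor \<D> g X Z) = 0"
proof -
  let ?m = "metric_origin l1 l2 l3"
  let ?\<phi> = "\<lambda>q. inv_metric l1 l2 l3 q (Y q) (Z q)"
  note x = vector_field_lift[OF assms(1,4)]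
  have \<phi>: "?\<phi> (quot h) = ?m (lift Y h) (lift Z h)" if "h \<in> SU3" for h
    using vector_field_lift[OF assms(2) that] vector_field_lift[OF assms(3) that] that
    by (simp add: inv_metric_tv)
  have "smoothG (\<lambda>h. ?m (lift Y h) (lift Z h))"
    by (rule smoothG_bilinear[OF bounded_bilinear_metric_origin smoothG_lift[OF assms(2)] smoothG_lift[OF assms(3)]])
  then have "smooth ?\<phi>"
    unfolding smooth_iff by (subst smoothG_cong[OF \<phi>])
  then have "deriv_along X ?\<phi> (quot g) = lderiv (\<lambda>h. ?\<phi> (quot h)) g (lift X g)"
    using x tv_apply[OF assms(4) x(1)] by (simp add: deriv_along_def)
  also have "\<dots> = lderiv (\<lambda>h. ?m (lift Y h) (lift Z h)) g (lift X g)"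
    by (rule lderiv_cong[OF \<phi> assms(4) x(1)])
  also have "\<dots> = ?m (lift Y g) (lderiv (lift Z) g (lift X g)) + ?m (lderiv (lift Y) g (lift X g)) (lift Z g)"
    by (rule lderiv_bilinear[OF bounded_bilinear_metric_origin smoothG_lift[OF assms(2)] smoothG_lift[OF assms(3)] assms(4) x(1)])
  finally have 1: "deriv_along X ?\<phi> (quot g) = \<dots>" .
  have "deriv_along X ?\<phi> (quot g) = inv_metric l1 l2 l3 (quot g) (\<D> X Y (quot g)) (Z (quot g)) +
      inv_metric l1 l2 l3 (quot g) (Y (quot g)) (\<D> X Z (quot g))"
    using lc assms by (simp add: levi_civita_def)
  also have "\<dots> = ?m (lift (\<D> X Y) g) (lift Z g) + ?m (lift Y g) (lift (\<D> X Z) g)"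
    using vector_field_lift[OF conn_vector_field[OF assms(1,2)] assms(4)]
      vector_field_lift[OF conn_vector_field[OF assms(1,3)] assms(4)]
      vector_field_lift[OF assms(2,4)] vector_field_lift[OF assms(3,4)] assms(4)
    by (simp add: inv_metric_tv)
  finally show ?thesis
    using 1 unfolding conn_tensor_def
    by (simp add: bounded_bilinear.diff_left[OF bounded_bilinear_metric_origin]
        bounded_bilinear.diff_right[OF bounded_bilinear_metric_origin])
qed

text \<open>The usual cyclic argument: skewness for the three cyclic orders of \<open>X\<close>,
  \<open>Y\<close>, \<open>Z\<close>, combined with vanishing torsion for the three pairs.\<close>

lemma koszul:
  assumes "X \<in> vector_fields" "Y \<in> vector_fields" "Z \<in> vector_fields" "g \<in> SU3"
  shows "2 * metric_origin l1 l2 l3 (conn_tensor \<D> g X Y) (lift Z g) =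
    koszul_form l1 l2 l3 (lift X g) (lift Y g) (lift Z g)"
  using conn_tensor_metric[OF assms(1,2,3,4)] conn_tensor_metric[OF assms(2,3,1,4)]
    conn_tensor_metric[OF assms(3,1,2,4)]
    metric_origin_sym[of l1 l2 l3 "lift X g" "conn_tensor \<D> g Z Y"]
    metric_origin_sym[of l1 l2 l3 "lift Y g" "conn_tensor \<D> g X Z"]
    metric_origin_sym[of l1 l2 l3 "lift Z g" "conn_tensor \<D> g Y X"]
  unfolding koszul_form_def conn_tensor_torsion[OF assms(1,2,4), symmetric] conn_tensor_torsion[OF assms(2,3,4), symmetric]
    conn_tensor_torsion[OF assms(3,1,4), symmetric]
    bounded_bilinear.diff_left[OF bounded_bilinear_metric_origin]
  by linarith

text \<open>\<open>f_origin\<close> is a fixed linear map, so it commutes with \<open>lderiv\<close>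
  and the derivative terms cancel.\<close>

lemma lift_cov_deriv:
  fixes z1 z2 z3 :: real
  assumes "X \<in> vector_fields" "Y \<in> vector_fields" "g \<in> SU3"
  defines "f \<equiv> inv_f z1 z2 z3"
  shows "cov_deriv11 \<D> f X Y \<in> vector_fields"
    "lift (cov_deriv11 \<D> f X Y) g =
      conn_tensor \<D> g X (app f Y) - f_origin z1 z2 z3 (conn_tensor \<D> g X Y)"
proof -
  note fY = vector_fields_app[OF assms(2), where ?z1.0 = z1 and ?z2.0 = z2 and ?z3.0 = z3, folded f_def]
  note v = conn_vector_field[OF assms(1) fY(1)]
    vector_fields_app[OF conn_vector_field[OF assms(1,2)], where ?z1.0 = z1 and ?z2.0 = z2 and ?z3.0 = z3, folded f_def]
  note x = vector_field_lift(1)[OF assms(1,3)]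
  show "cov_deriv11 \<D> f X Y \<in> vector_fields"
    unfolding cov_deriv11_def by (rule vector_fields_diff(1)[OF v(1,2)])
  have "lderiv (lift (app f Y)) g (lift X g) = lderiv (\<lambda>h. f_origin z1 z2 z3 (lift Y h)) g (lift X g)"
    by (rule lderiv_cong[OF fY(2) assms(3) x])
  also have "\<dots> = f_origin z1 z2 z3 (lderiv (lift Y) g (lift X g))"
    by (rule lderiv_compose_linear[OF bounded_linear_f_origin smoothG_lift[OF assms(2)] assms(3) x])
  finally show "lift (cov_deriv11 \<D> f X Y) g =
      conn_tensor \<D> g X (app f Y) - f_origin z1 z2 z3 (conn_tensor \<D> g X Y)"
    unfolding cov_deriv11_def vector_fields_diff(2)[OF v(1,2) assms(3)] v(3)[OF assms(3)]
    by (simp add: conn_tensor_def linear_diff[OF linear_f_origin])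
qed

end

subsection \<open>The composition tensor\<close>

text \<open>In the coordinates \<open>(a, b, c)\<close> this is the complex conjugate of the cross
  product; each component involves only the other two.\<close>

lemma comm_m_params:
  assumes "A \<in> \<mm>" "B \<in> \<mm>"
  shows "param_a (comm_m A B) = cnj (param_b A * param_c B - param_c A * param_b B)"
    "param_b (comm_m A B) = cnj (param_c A * param_a B - param_a A * param_c B)"
    "param_c (comm_m A B) = cnj (param_a A * param_b B - param_b A * param_a B)"
  using assms
  by (auto elim!: m_cases simp: param_a_def param_b_def param_c_def comm_m_def offdiag_entry comm_def
      matrix_matrix_mult_def sum_3 algebra_simps)

text \<open>The two covariant derivatives of \<open>f\<close> in the composition tensor, paired with
  \<open>C\<close>. Where \<open>f\<close> acts on the connection term it is moved to
  \<open>C\<close> by skewness, which flips the sign.\<close>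

definition composition_form :: "real \<Rightarrow> real \<Rightarrow> real \<Rightarrow> (cmat \<Rightarrow> cmat) \<Rightarrow> cmat \<Rightarrow> cmat \<Rightarrow> cmat \<Rightarrow> real" where
  "composition_form l1 l2 l3 f A B C =
    koszul_form l1 l2 l3 A (f B) C + koszul_form l1 l2 l3 A B (f C) -
    koszul_form l1 l2 l3 (f A) (f (f B)) C - koszul_form l1 l2 l3 (f A) (f B) (f C)"

text \<open>The Koszul form is a real combination of terms \<open>Re (x * y * z)\<close>, with
  \<open>x\<close>, \<open>y\<close>, \<open>z\<close> coordinates of the three arguments at
  distinct positions. If some \<open>z1\<close>, \<open>z2\<close>, \<open>z3\<close> is zero, one
  factor vanishes. Otherwise all squares are 1 and each product acquires the factor
  \<open>\<i> * (z1 + z2 + z3 + z1 * z2 * z3)\<close>, which is zero for the listed sign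
  patterns.\<close>

lemma composition_form_zero:
  fixes z1 z2 z3 :: real
  assumes "(z1, z2, z3) \<in> {(1, -1, 1), (1, 1, -1), (1, -1, -1),
      (1, 1, 0), (1, 0, 1), (0, 1, 1), (1, -1, 0), (1, 0, -1), (0, 1, -1),
      (1, 0, 0), (0, 1, 0), (0, 0, 1)}"
  defines "f \<equiv> f_origin z1 z2 z3"
  shows "composition_form l1 l2 l3 f (f A) (f B) (f C) = 0"
  using assms(1) unfolding f_def composition_form_def koszul_form_def metric_origin_eq
  by (elim insertE emptyE) (simp_all add: comm_m_params algebra_simps)

text \<open>The factor \<open>- 8\<close> collects the 1/4 of the composition tensor, the sign from
  moving the outer \<open>f\<close> to \<open>Z\<close>, and the 2 of the Koszul formula.\<close>

lemma lift_composition_tensor: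
  assumes "levi_civita (inv_metric l1 l2 l3) \<D>"
    "X \<in> vector_fields" "Y \<in> vector_fields" "Z \<in> vector_fields" "g \<in> SU3"
  shows "composition_tensor \<D> (inv_f z1 z2 z3) X Y \<in> vector_fields"
    "- 8 * metric_origin l1 l2 l3 (lift (composition_tensor \<D> (inv_f z1 z2 z3) X Y) g) (lift Z g) =
      composition_form l1 l2 l3 (f_origin z1 z2 z3) (f_origin z1 z2 z3 (lift X g))
        (f_origin z1 z2 z3 (lift Y g)) (f_origin z1 z2 z3 (lift Z g))"
proof -
  let ?f = "inv_f z1 z2 z3" and ?fo = "f_origin z1 z2 z3" and ?m = "metric_origin l1 l2 l3"
  note cov = lift_cov_deriv[OF assms(1) _ _ assms(5), where ?z1.0 = z1 and ?z2.0 = z2 and ?z3.0 = z3]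
  note app = vector_fields_app(1)[where ?z1.0 = z1 and ?z2.0 = z2 and ?z3.0 = z3]
  note lift_app = vector_fields_app(2)[OF _ assms(5), where ?z1.0 = z1 and ?z2.0 = z2 and ?z3.0 = z3]
  note m = bounded_bilinear.add_left[OF bounded_bilinear_metric_origin]
    bounded_bilinear.diff_left[OF bounded_bilinear_metric_origin]
  let ?U = "app ?f X" and ?V = "app ?f Y" and ?W = "app ?f Z"
  have v: "?U \<in> vector_fields" "?V \<in> vector_fields" "?W \<in> vector_fields"
    "app ?f ?U \<in> vector_fields" "app ?f ?V \<in> vector_fields" "app ?f ?W \<in> vector_fields"
    "app ?f (app ?f ?V) \<in> vector_fields"
    using assms app by blast+
  let ?C1 = "cov_deriv11 \<D> ?f ?U ?V" and ?C2 = "cov_deriv11 \<D> ?f (app ?f ?U) (app ?f ?V)"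
  have c: "?C1 \<in> vector_fields" "?C2 \<in> vector_fields" using v cov(1) by blast+
  note c' = vector_fields_diff[OF c]
  show "composition_tensor \<D> ?f X Y \<in> vector_fields"
    unfolding composition_tensor_def using c' by (intro vector_fields_smul_const app)
  have "lift (composition_tensor \<D> ?f X Y) g = (1 / 4) *\<^sub>R ?fo (lift ?C1 g - lift ?C2 g)"
    unfolding composition_tensor_def
    by (simp add: vector_fields_smul_const(2)[OF app[OF c'(1)] assms(5)] lift_app[OF c'(1)] c'(2)[OF assms(5)])
  then have "?m (lift (composition_tensor \<D> ?f X Y) g) (lift Z g) =
      - (1 / 4) * ?m (lift ?C1 g - lift ?C2 g) (?fo (lift Z g))"
    by (simp only: bounded_bilinear.scaleR_left[OF bounded_bilinear_metric_origin] metric_origin_f_skew) simp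
  then have "- 8 * ?m (lift (composition_tensor \<D> ?f X Y) g) (lift Z g) =
      2 * ?m (lift ?C1 g - lift ?C2 g) (lift ?W g)"
    by (simp add: lift_app[OF assms(4)])
  \<comment> \<open>Skewness moves the \<open>f\<close> inside each covariant derivative onto
    \<open>?W\<close>, so every term has the shape required by \<open>koszul\<close>.\<close>
  also have "\<dots> = 2 * ?m (conn_tensor \<D> g ?U (app ?f ?V)) (lift ?W g)
      + 2 * ?m (conn_tensor \<D> g ?U ?V) (lift (app ?f ?W) g)
      - 2 * ?m (conn_tensor \<D> g (app ?f ?U) (app ?f (app ?f ?V))) (lift ?W g)
      - 2 * ?m (conn_tensor \<D> g (app ?f ?U) (app ?f ?V)) (lift (app ?f ?W) g)"
    using v by (simp add: cov(2) m metric_origin_f_skew lift_app)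
  also have "\<dots> = composition_form l1 l2 l3 ?fo (lift ?U g) (lift ?V g) (lift ?W g)"
    unfolding composition_form_def
    using v by (simp only: koszul[OF assms(1) _ _ _ assms(5)]) (simp only: lift_app)
  finally show "- 8 * ?m (lift (composition_tensor \<D> ?f X Y) g) (lift Z g) =
      composition_form l1 l2 l3 ?fo (?fo (lift X g)) (?fo (lift Y g)) (?fo (lift Z g))"
    by (simp add: lift_app assms)
qed

lemma composition_tensor_zero:
  assumes "l1 > 0" "l2 > 0" "l3 > 0" "levi_civita (inv_metric l1 l2 l3) \<D>"
    "X \<in> vector_fields" "Y \<in> vector_fields"
    "\<And>A B C. composition_form l1 l2 l3 (f_origin z1 z2 z3) (f_origin z1 z2 z3 A)
      (f_origin z1 z2 z3 B) (f_origin z1 z2 z3 C) = 0"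
  shows "composition_tensor \<D> (inv_f z1 z2 z3) X Y = 0"
proof -
  let ?T = "composition_tensor \<D> (inv_f z1 z2 z3) X Y"
  have T: "?T \<in> vector_fields"
    by (rule lift_composition_tensor(1)[OF assms(4,5,6,5) SU3_one])
  show ?thesis
  proof (rule vector_field_zeroI[OF T])
    fix g assume g: "g \<in> SU3"
    have "metric_origin l1 l2 l3 (lift ?T g) (lift ?T g) = 0"
      using lift_composition_tensor(2)[OF assms(4,5,6) T g, of z1 z2 z3] assms(7) by simp
    then show "lift ?T g = 0"
      using metric_origin_definite assms(1-3) vector_field_lift(1)[OF T g] by blast
  qed
qed

subsection \<open>Metric f-structures\<close>

lemma tensor_field11_inv_f: "tensor_field11 (inv_f z1 z2 z3)"
  unfolding tensor_field11_def
proof (intro conjI allI ballI)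
  fix p v w and r :: real
  obtain g where g: "g \<in> SU3" "p = quot g" by (rule quot_surj)
  note ts = tangent_space_quot[OF g(1)]
  assume "v \<in> tangent_space p"
  then obtain A where A: "A \<in> \<mm>" "v = tv g A" using ts g(2) by blast
  show "inv_f z1 z2 z3 p v \<in> tangent_space p"
    using g A ts by (simp add: inv_f_tv)
  show "inv_f z1 z2 z3 p (scale r v) = scale r (inv_f z1 z2 z3 p v)"
    using g A by (simp add: tv_scale[symmetric] inv_f_tv m_scaleR linear_scale[OF linear_f_origin])
  assume "w \<in> tangent_space p"
  then obtain B where B: "B \<in> \<mm>" "w = tv g B" using ts g(2) by blast
  show "inv_f z1 z2 z3 p (v + w) = inv_f z1 z2 z3 p v + inv_f z1 z2 z3 p w"
    using g A B by (simp add: tv_add[symmetric] inv_f_tv m_add linear_add[OF linear_f_origin])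
qed (rule vector_fields_app)

lemma metric_f_structure_inv:
  assumes "z1 ^ 3 = z1" "z2 ^ 3 = z2" "z3 ^ 3 = z3"
  shows "metric_f_structure (inv_metric l1 l2 l3) (inv_f z1 z2 z3)"
  unfolding metric_f_structure_def f_structure_def
proof (intro conjI ballI allI tensor_field11_inv_f)
  let ?f = "inv_f z1 z2 z3" and ?fo = "f_origin z1 z2 z3"
  note app = vector_fields_app[where ?z1.0 = z1 and ?z2.0 = z2 and ?z3.0 = z3]
  \<comment> \<open>On each coordinate \<open>f\<close> is multiplication by
    \<open>\<i> * z\<close>, and its cube plus itself is \<open>\<i> * (z - z ^ 3)\<close>.\<close>
  have cube: "?fo (?fo (?fo A)) + ?fo A = 0" for A
  proof -
    have "complex_of_real z1 ^ 3 = of_real z1" "complex_of_real z2 ^ 3 = of_real z2"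
      "complex_of_real z3 ^ 3 = of_real z3"
      using assms by (metis of_real_power)+
    then show ?thesis
      by (auto simp: f_origin_def vec_eq_iff forall_3 power3_eq_cube algebra_simps)
  qed
  fix X assume X: "X \<in> vector_fields"
  show "app ?f (app ?f (app ?f X)) + app ?f X = 0"
    by (rule vector_field_zeroI) (simp_all add: X app vector_fields_add cube)
  fix Y p assume Y: "Y \<in> vector_fields"
  obtain g where g: "g \<in> SU3" "p = quot g" by (rule quot_surj)
  show "inv_metric l1 l2 l3 p (app ?f X p) (Y p) + inv_metric l1 l2 l3 p (X p) (app ?f Y p) = 0"
    using vector_field_lift[OF X g(1)] vector_field_lift[OF Y g(1)] g
    by (simp add: app_def inv_f_tv inv_metric_tv metric_origin_f_skew)
qed

theorem proposition4:
  fixes t s :: real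
  assumes "t > 0" and "s > 0"
  shows "\<forall>(z1, z2, z3) \<in> {
      (1, -1, 1), (1, 1, -1), (1, -1, -1),
      (1, 1, 0), (1, 0, 1), (0, 1, 1), (1, -1, 0), (1, 0, -1), (0, 1, -1),
      (1, 0, 0), (0, 1, 0), (0, 0, 1)}.
    hermitian_f_structure (inv_metric 1 t s) (inv_f z1 z2 z3)"
proof (clarify del: insertE)
  \<comment> \<open>Membership in the list is kept as one hypothesis; the case split takes place in
    \<open>composition_form_zero\<close>.\<close>
  fix z1 z2 z3 :: real
  assume z: "(z1, z2, z3) \<in> {
      (1, -1, 1), (1, 1, -1), (1, -1, -1),
      (1, 1, 0), (1, 0, 1), (0, 1, 1), (1, -1, 0), (1, 0, -1), (0, 1, -1),
      (1, 0, 0), (0, 1, 0), (0, 0, 1)}"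
  \<comment> \<open>All entries are -1, 0 or 1, the real roots of \<open>z ^ 3 = z\<close>.\<close>
  then have "z1 ^ 3 = z1" "z2 ^ 3 = z2" "z3 ^ 3 = z3" by auto
  then show "hermitian_f_structure (inv_metric 1 t s) (inv_f z1 z2 z3)"
    unfolding hermitian_f_structure_def
    by (intro conjI allI impI ballI metric_f_structure_inv
        composition_tensor_zero[OF zero_less_one assms] composition_form_zero[OF z])
qed

end
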